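(* Let $a<b$ be fixed real numbers. Let $f_1,f_2\in C^2([a,b])$ satisfy $f_1(a)=f_2(a)=f_1(b)=f_2(b)=0$ and $f_2(x)>f_1(x)$ for all $x\in(a,b)$, with $f_1$ convex and $f_2$ concave. For $\epsilon>0$ let $$\Omega_\epsilon=\{(x,y)\in\mathbb{R}^2:\ \epsilon f_1(x)<y<\epsilon f_2(x),\ x\in(a,b)\},$$ and let $u_\epsilon$ be the torsion function of $\Omega_\epsilon$. Assume that $f_2-f_1$ has a unique maximizer $x=z_0\in(a,b)$. If the curvature of $\partial\Omega_1$ at $(z_0,f_1(z_0))$ is strictly smaller than the curvature of $\partial\Omega_1$ at $(z_0,f_2(z_0))$, then there exists $\epsilon_0>0$ such that for all $0<\epsilon<\epsilon_0$, $$|\nabla u_\epsilon(z_0,\epsilon f_1(z_0))|>|\nabla u_\epsilon(z_0,\epsilon f_2(z_0))|.$$ In particular, for all sufficiently small $\epsilon>0$, the fail points of $\Omega_\epsilon$ always lie on the graph of $\epsilon f_1$.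
   Context: The torsion function $u_\epsilon$ of $\Omega_\epsilon$ is the unique solution of $-\Delta u_\epsilon=1$ in $\Omega_\epsilon$, $u_\epsilon=0$ on $\partial\Omega_\epsilon$; it is $C^1$ up to the boundary. A fail point of $\Omega_\epsilon$ is a point of $\partial\Omega_\epsilon$ at which $|\nabla u_\epsilon|$ attains its maximum over $\partial\Omega_\epsilon$. $\Omega_1$ denotes $\Omega_\epsilon$ with $\epsilon=1$. The curvature of the boundary of the convex domain $\Omega_1$ is taken with the sign for which it is nonnegative: at $(x,f_1(x))$ it is $f_1''(x)/(1+f_1'(x)^2)^{3/2}$ and at $(x,f_2(x))$ it is $-f_2''(x)/(1+f_2'(x)^2)^{3/2}$. *)

theory Defs
  imports "HOL-Analysis.Analysis"
begin

text \<open>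
  Class \<open>C\<^sup>2\<close> on a closed interval, with one-sided derivatives at the end points.
\<close>
definition C2_on_Icc :: "real \<Rightarrow> real \<Rightarrow> (real \<Rightarrow> real) \<Rightarrow> bool" where
  "C2_on_Icc a b f \<longleftrightarrow>
     (\<exists>f' f''. (\<forall>x\<in>{a..b}. (f has_real_derivative f' x) (at x within {a..b})) \<and>
               (\<forall>x\<in>{a..b}. (f' has_real_derivative f'' x) (at x within {a..b})) \<and>
               continuous_on {a..b} f'')"

definition gradient :: "('a::euclidean_space \<Rightarrow> real) \<Rightarrow> 'a \<Rightarrow> 'a" where
  "gradient u p = (THE D. GDERIV u p :> D)"

text \<open>The Laplacian is the divergence of the gradient, that is, the trace of its derivative.\<close>
definition laplacian :: "('a::euclidean_space \<Rightarrow> real) \<Rightarrow> 'a \<Rightarrow> real" where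
  "laplacian u p = (\<Sum>b\<in>Basis. frechet_derivative (gradient u) (at p) b \<bullet> b)"

definition C2_inside :: "'a::euclidean_space set \<Rightarrow> ('a \<Rightarrow> real) \<Rightarrow> bool" where
  "C2_inside \<Omega> u \<longleftrightarrow>
     (\<forall>p\<in>\<Omega>. u differentiable (at p)) \<and>
     (\<forall>p\<in>\<Omega>. gradient u differentiable (at p)) \<and>
     (\<forall>h. continuous_on \<Omega> (\<lambda>p. frechet_derivative (gradient u) (at p) h))"

text \<open>
  A function is \<open>C\<^sup>1\<close> up to the boundary of an open set if it is continuous on the closure and
  its gradient, which is defined inside, has a continuous extension to the closure.
\<close>
definition C1_upto_boundary :: "'a::euclidean_space set \<Rightarrow> ('a \<Rightarrow> real) \<Rightarrow> bool" where
  "C1_upto_boundary \<Omega> u \<longleftrightarrow>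
     continuous_on (closure \<Omega>) u \<and>
     (\<exists>g. continuous_on (closure \<Omega>) g \<and> (\<forall>p\<in>\<Omega>. GDERIV u p :> g p))"

text \<open>
  The value at a boundary point of the continuous extension of the gradient. Only the values of
  \<open>u\<close> inside \<open>\<Omega>\<close> enter, so nothing is assumed about \<open>u\<close> outside the closure.
\<close>
definition boundary_gradient :: "'a::euclidean_space set \<Rightarrow> ('a \<Rightarrow> real) \<Rightarrow> 'a \<Rightarrow> 'a" where
  "boundary_gradient \<Omega> u p = Lim (at p within \<Omega>) (gradient u)"

text \<open>
  A classical solution of the torsion problem which is \<open>C\<^sup>1\<close> up to the boundary. On a bounded
  domain there is at most one such function, up to its values outside the closure.
\<close>
definition torsion_function :: "'a::euclidean_space set \<Rightarrow> ('a \<Rightarrow> real) \<Rightarrow> bool" where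
  "torsion_function \<Omega> u \<longleftrightarrow>
     C2_inside \<Omega> u \<and> C1_upto_boundary \<Omega> u \<and>
     (\<forall>p\<in>\<Omega>. - laplacian u p = 1) \<and>
     (\<forall>p\<in>frontier \<Omega>. u p = 0)"

definition fail_points :: "'a::euclidean_space set \<Rightarrow> ('a \<Rightarrow> real) \<Rightarrow> 'a set" where
  "fail_points \<Omega> u =
     {p \<in> frontier \<Omega>. \<forall>q\<in>frontier \<Omega>.
        norm (boundary_gradient \<Omega> u q) \<le> norm (boundary_gradient \<Omega> u p)}"

definition thin_domain ::
  "real \<Rightarrow> real \<Rightarrow> (real \<Rightarrow> real) \<Rightarrow> (real \<Rightarrow> real) \<Rightarrow> real \<Rightarrow> (real \<times> real) set" where
  "thin_domain a b f1 f2 \<epsilon> = {(x, y). a < x \<and> x < b \<and> \<epsilon> * f1 x < y \<and> y < \<epsilon> * f2 x}"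

text \<open>
  Curvature of the boundary of \<open>{(x, y). f1 x < y \<and> y < f2 x}\<close>, signed so that it is nonnegative
  when \<open>f1\<close> is convex and \<open>f2\<close> is concave; for interior points \<open>x\<close> of the interval.
\<close>
definition lower_curvature :: "(real \<Rightarrow> real) \<Rightarrow> real \<Rightarrow> real" where
  "lower_curvature f1 x = deriv (deriv f1) x / (1 + (deriv f1 x)\<^sup>2) powr (3 / 2)"

definition upper_curvature :: "(real \<Rightarrow> real) \<Rightarrow> real \<Rightarrow> real" where
  "upper_curvature f2 x = - deriv (deriv f2) x / (1 + (deriv f2 x)\<^sup>2) powr (3 / 2)"

end

theory Submission
  imports Defs
begin

text \<open>
  Rescaling \<open>v(x, y) = u(x, \<epsilon> y) / \<epsilon>\<^sup>2\<close> turns the torsion problem into \<open>v\<^sub>y\<^sub>y + \<epsilon>\<^sup>2 v\<^sub>x\<^sub>x = -1\<close> on the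
  fixed domain \<open>\<Omega>\<^sub>1\<close>, whose limit as \<open>\<epsilon> \<rightarrow> 0\<close> is solved by \<open>v0 = (y - f1) (f2 - y) / 2\<close>. The maximum
  principle applied to multiples \<open>v0 (1 + \<epsilon>\<^sup>2 G)\<close>, which vanish on the boundary, first with constant
  \<open>G\<close> gives \<open>v = v0 (1 + O(\<epsilon>\<^sup>2))\<close> globally, and then with \<open>G = c + r y \<plusminus> (2 \<eta> + k (x - x0)\<^sup>2)\<close> gives
  \<open>v = v0 (1 + \<epsilon>\<^sup>2 (c + r y + O(\<eta>)))\<close> near \<open>x = z0\<close>, where \<open>6 r = f1'' + f2''\<close> at \<open>z0\<close>. Since
  \<open>f1' = f2'\<close> at \<open>z0\<close>, the curvature hypothesis says \<open>r < 0\<close>, so the factor is larger on the lower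
  graph. Away from \<open>z0\<close> the leading term \<open>\<epsilon> (f2 - f1) / 2\<close> of the gradient is already smaller than
  at \<open>z0\<close>.
\<close>

section \<open>Second derivative test and minimum principle on the region between the graphs\<close>

text \<open>If \<open>d < 0\<close>, then \<open>f'\<close> vanishes at \<open>x\<close> and is
  negative just to the right of it, so the mean value theorem produces a smaller value of
  \<open>f\<close> there. The second derivative is asked for only at the point
  \<open>x\<close>.\<close>

lemma second_derivative_at_min_nonneg:
  fixes f f' :: "real \<Rightarrow> real"
  assumes "open S" and "x \<in> S"
    and f: "\<And>t. t \<in> S \<Longrightarrow> (f has_real_derivative f' t) (at t)"
    and f': "(f' has_real_derivative d) (at x)"
    and min: "\<And>t. t \<in> S \<Longrightarrow> f x \<le> f t"
  shows "d \<ge> 0"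
proof (rule ccontr)
  assume "\<not> d \<ge> 0"
  then have "d < 0" by simp
  obtain e where e: "e > 0" "\<And>t. \<bar>x - t\<bar> < e \<Longrightarrow> t \<in> S"
    using \<open>open S\<close> \<open>x \<in> S\<close> unfolding open_dist by (metis dist_real_def dist_commute)
  have "f' x = 0"
    using DERIV_local_min[OF f[OF \<open>x \<in> S\<close>] e(1)] min e(2) by blast
  with DERIV_neg_dec_right[OF f' \<open>d < 0\<close>] obtain e' where
    e': "e' > 0" "\<And>h. 0 < h \<Longrightarrow> h < e' \<Longrightarrow> f' (x + h) < 0" by auto
  define h where "h = min e e' / 2"
  have h: "h > 0" "h < e" "h < e'" using e(1) e'(1) by (auto simp: h_def)
  obtain z where z: "z > x" "z < x + h" "f (x + h) - f x = (x + h - x) * f' z"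
    using MVT2[of x "x + h" f f'] h e(2) f by auto
  have "f' z < 0" using e'(2)[of "z - x"] z h by auto
  then have "h * f' z < 0" using h(1) by (rule mult_pos_neg[rotated])
  then have "f (x + h) < f x" using z(3) by simp
  moreover have "x + h \<in> S" using e(2) h by auto
  ultimately show False using min by force
qed

text \<open>The derivatives are parameters because at the end points they are one-sided, where the
  two-sided \<open>deriv\<close> would not give them.\<close>

locale profiles =
  fixes a b :: real and f1 f1' f1'' f2 f2' f2'' :: "real \<Rightarrow> real"
  assumes ab: "a < b"
    and f1: "\<And>x. x \<in> {a..b} \<Longrightarrow> (f1 has_real_derivative f1' x) (at x within {a..b})"
    and f1': "\<And>x. x \<in> {a..b} \<Longrightarrow> (f1' has_real_derivative f1'' x) (at x within {a..b})"
    and f1'': "continuous_on {a..b} f1''"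
    and f2: "\<And>x. x \<in> {a..b} \<Longrightarrow> (f2 has_real_derivative f2' x) (at x within {a..b})"
    and f2': "\<And>x. x \<in> {a..b} \<Longrightarrow> (f2' has_real_derivative f2'' x) (at x within {a..b})"
    and f2'': "continuous_on {a..b} f2''"
    and ends: "f1 a = 0" "f2 a = 0" "f1 b = 0" "f2 b = 0"
    and less: "\<And>x. x \<in> {a<..<b} \<Longrightarrow> f1 x < f2 x"
begin

lemma le: "x \<in> {a..b} \<Longrightarrow> f1 x \<le> f2 x"
  using less[of x] ends by (cases "x = a"; cases "x = b") auto

lemma at_interior:
  "x \<in> {a<..<b} \<Longrightarrow> (f1 has_real_derivative f1' x) (at x)"
  "x \<in> {a<..<b} \<Longrightarrow> (f1' has_real_derivative f1'' x) (at x)"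
  "x \<in> {a<..<b} \<Longrightarrow> (f2 has_real_derivative f2' x) (at x)"
  "x \<in> {a<..<b} \<Longrightarrow> (f2' has_real_derivative f2'' x) (at x)"
  using f1[of x] f1'[of x] f2[of x] f2'[of x] by (simp_all add: at_within_Icc_at)

lemma cont:
  "continuous_on {a..b} f1" "continuous_on {a..b} f1'"
  "continuous_on {a..b} f2" "continuous_on {a..b} f2'"
  using f1 f1' f2 f2' by (blast intro: DERIV_continuous_on)+

text \<open>\<open>strip a b\<close> is the closure of the domain for \<open>\<epsilon> = 1\<close>;
  shorter intervals serve the local comparison around a single abscissa.\<close>

definition strip :: "real \<Rightarrow> real \<Rightarrow> (real \<times> real) set" where
  "strip c d = {(x, y). x \<in> {c..d} \<and> y \<in> {f1 x..f2 x}}"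

text \<open>Straightens the region to a rectangle, from which it inherits compactness as a
  continuous image.\<close>

lemma strip_eq_image:
  assumes "a \<le> c" "d \<le> b"
  shows "strip c d = (\<lambda>(x, s). (x, f1 x + s * (f2 x - f1 x))) ` ({c..d} \<times> {0..1})"
proof (intro equalityI subsetI)
  fix p assume "p \<in> strip c d"
  then obtain x y where p: "p = (x, y)" and x: "x \<in> {c..d}" and y: "f1 x \<le> y" "y \<le> f2 x"
    by (auto simp: strip_def)
  \<comment> \<open>Where the graphs meet, \<open>y\<close> equals both of them and every
    \<open>s\<close> would do.\<close>
  define s where "s = (if f1 x = f2 x then 0 else (y - f1 x) / (f2 x - f1 x))"
  have "s \<in> {0..1}" "y = f1 x + s * (f2 x - f1 x)"
    using y by (auto simp: s_def divide_simps)
  then show "p \<in> (\<lambda>(x, s). (x, f1 x + s * (f2 x - f1 x))) ` ({c..d} \<times> {0..1})"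
    using p x by (intro image_eqI[where x = "(x, s)"]) auto
next
  fix p assume "p \<in> (\<lambda>(x, s). (x, f1 x + s * (f2 x - f1 x))) ` ({c..d} \<times> {0..1})"
  then obtain q where q: "q \<in> {c..d} \<times> {0..1}"
    and pq: "p = (\<lambda>(x, s). (x, f1 x + s * (f2 x - f1 x))) q" by blast
  obtain x s where "q = (x, s)" by (cases q)
  with q pq have p: "p = (x, f1 x + s * (f2 x - f1 x))" and x: "x \<in> {c..d}"
    and s: "0 \<le> s" "s \<le> 1" by auto
  have "f1 x \<le> f2 x" using le x assms by auto
  then have "0 \<le> s * (f2 x - f1 x)" "s * (f2 x - f1 x) \<le> 1 * (f2 x - f1 x)"
    using s mult_right_mono[OF s(2), of "f2 x - f1 x"] by simp_all
  then show "p \<in> strip c d" using x by (auto simp: p strip_def)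
qed

lemma continuous_on_fst_comp:
  assumes "continuous_on {a..b} f" "S \<subseteq> {a..b} \<times> UNIV"
  shows "continuous_on S (\<lambda>p. f (fst p))"
  using assms by (auto intro!: continuous_on_compose2[OF assms(1)] continuous_intros)

lemma compact_strip:
  assumes "a \<le> c" "d \<le> b"
  shows "compact (strip c d)"
  unfolding strip_eq_image[OF assms] case_prod_beta using assms
  by (intro compact_continuous_image compact_Times continuous_intros continuous_on_fst_comp cont) auto

lemma strip_mono: "a \<le> c \<Longrightarrow> d \<le> b \<Longrightarrow> strip c d \<subseteq> strip a b"
  by (auto simp: strip_def)

text \<open>Lets the one-variable second derivative test run in the \<open>x\<close> direction at a
  fixed height.\<close>

lemma open_slice: "open {t. t \<in> {a<..<b} \<and> f1 t < y \<and> y < f2 t}"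
proof -
  have "open ({a<..<b} \<inter> f1 -` {..<y})" "open ({a<..<b} \<inter> f2 -` {y<..})"
    by (intro continuous_open_preimage open_greaterThanLessThan open_lessThan open_greaterThan
        continuous_on_subset[OF cont(1)] continuous_on_subset[OF cont(3)]; force)+
  then have "open (({a<..<b} \<inter> f1 -` {..<y}) \<inter> ({a<..<b} \<inter> f2 -` {y<..}))" by (rule open_Int)
  then show ?thesis by (rule back_subst) auto
qed

text \<open>A negative minimum over the compact strip would lie off the graphs and off the sides.
  There both pure second derivatives are nonnegative, against the strict differential inequality.
  The sides have hypotheses of their own, so that the principle also applies over a short interval
  \<open>{c..d}\<close>.\<close>

lemma minimum_principle:
  fixes w wx wxx wy wyy :: "real \<Rightarrow> real \<Rightarrow> real"
  assumes cd: "a \<le> c" "d \<le> b"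
    and cont_w: "continuous_on (strip c d) (\<lambda>(x, y). w x y)"
    and graphs: "\<And>x. x \<in> {c..d} \<Longrightarrow> 0 \<le> w x (f1 x) \<and> 0 \<le> w x (f2 x)"
    and sides: "\<And>y. y \<in> {f1 c..f2 c} \<Longrightarrow> 0 \<le> w c y" "\<And>y. y \<in> {f1 d..f2 d} \<Longrightarrow> 0 \<le> w d y"
    and derivs: "\<And>x y. x \<in> {c<..<d} \<Longrightarrow> y \<in> {f1 x<..<f2 x} \<Longrightarrow>
        ((\<lambda>t. w t y) has_real_derivative wx x y) (at x) \<and>
        ((\<lambda>t. wx t y) has_real_derivative wxx x y) (at x) \<and>
        (w x has_real_derivative wy x y) (at y) \<and>
        (wy x has_real_derivative wyy x y) (at y) \<and>
        \<epsilon>\<^sup>2 * wxx x y + wyy x y < 0"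
    and "x \<in> {c..d}" "y \<in> {f1 x..f2 x}"
  shows "0 \<le> w x y"
proof (rule ccontr)
  assume neg: "\<not> 0 \<le> w x y"
  have mem: "(x, y) \<in> strip c d" using assms by (auto simp: strip_def)
  obtain p where p: "p \<in> strip c d"
    and min: "\<And>q. q \<in> strip c d \<Longrightarrow> (\<lambda>(x, y). w x y) p \<le> (\<lambda>(x, y). w x y) q"
    using continuous_attains_inf[OF compact_strip[OF cd] _ cont_w] mem by blast
  obtain s t where st: "p = (s, t)" by (cases p)
  have "w s t < 0" using min[OF mem] neg st by auto
  have s': "s \<in> {c..d}" "t \<in> {f1 s..f2 s}" using p st by (auto simp: strip_def)
  have "s \<noteq> c" "s \<noteq> d" using sides s' \<open>w s t < 0\<close> by force+
  then have s: "s \<in> {c<..<d}" using s' by auto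
  have "t \<noteq> f1 s" "t \<noteq> f2 s" using graphs[OF s'(1)] \<open>w s t < 0\<close> by auto
  then have t: "t \<in> {f1 s<..<f2 s}" using s' by auto
  note D = derivs[OF s t]
  \<comment> \<open>The slice is cut down to \<open>{c<..<d}\<close> because minimality is known
    only over \<open>strip c d\<close>.\<close>
  let ?S = "{c<..<d} \<inter> {r. r \<in> {a<..<b} \<and> f1 r < t \<and> t < f2 r}"
  have "open ?S" by (intro open_Int open_slice) auto
  then have "0 \<le> wxx s t"
    by (rule second_derivative_at_min_nonneg[where f = "\<lambda>r. w r t" and f' = "\<lambda>r. wx r t" and x = s])
      (use s t D derivs min cd in \<open>auto simp: st strip_def\<close>)
  moreover have "0 \<le> wyy s t"
    by (rule second_derivative_at_min_nonneg[where f = "w s" and f' = "wy s" and x = t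
          and S = "{f1 s<..<f2 s}"])
      (use s t D derivs min in \<open>auto simp: st strip_def\<close>)
  ultimately have "0 \<le> \<epsilon>\<^sup>2 * wxx s t + wyy s t" by simp
  with D show False by simp
qed

section \<open>The limit profile and the barriers built from it\<close>

definition v0 :: "real \<Rightarrow> real \<Rightarrow> real" where
  "v0 x y = (y - f1 x) * (f2 x - y) / 2"

definition v0x :: "real \<Rightarrow> real \<Rightarrow> real" where
  "v0x x y = ((y - f1 x) * f2' x - f1' x * (f2 x - y)) / 2"

definition v0xx :: "real \<Rightarrow> real \<Rightarrow> real" where
  "v0xx x y = ((y - f1 x) * f2'' x - 2 * f1' x * f2' x - f1'' x * (f2 x - y)) / 2"

lemma v0_nonneg: "y \<in> {f1 x..f2 x} \<Longrightarrow> 0 \<le> v0 x y"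
  by (simp add: v0_def)

lemma v0_deriv:
  assumes "x \<in> {a<..<b}"
  shows "((\<lambda>t. v0 t y) has_real_derivative v0x x y) (at x)"
    and "((\<lambda>t. v0x t y) has_real_derivative v0xx x y) (at x)"
    and "(v0 x has_real_derivative (f1 x + f2 x - 2 * y) / 2) (at y)"
  unfolding v0_def v0x_def v0xx_def
  by (auto intro!: derivative_eq_intros at_interior[OF assms] simp: field_simps)

lemma cont_v0:
  "continuous_on (strip a b) (\<lambda>p. v0 (fst p) (snd p))"
  "continuous_on (strip a b) (\<lambda>p. v0x (fst p) (snd p))"
  "continuous_on (strip a b) (\<lambda>p. v0xx (fst p) (snd p))"
  unfolding v0_def v0x_def v0xx_def
  by (intro continuous_intros continuous_on_fst_comp cont f1'' f2''; force simp: strip_def)+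

text \<open>Only pure partial derivatives along lines parallel to the axes are recorded, which is
  the form that the minimum principle consumes.\<close>

definition rescaled_solution :: "real \<Rightarrow> (real \<Rightarrow> real \<Rightarrow> real) \<Rightarrow> bool" where
  "rescaled_solution \<epsilon> v \<longleftrightarrow>
     continuous_on (strip a b) (\<lambda>(x, y). v x y) \<and>
     (\<forall>x\<in>{a..b}. v x (f1 x) = 0 \<and> v x (f2 x) = 0) \<and>
     (\<exists>vx vxx vy vyy. \<forall>x\<in>{a<..<b}. \<forall>y\<in>{f1 x<..<f2 x}.
        ((\<lambda>t. v t y) has_real_derivative vx x y) (at x) \<and>
        ((\<lambda>t. vx t y) has_real_derivative vxx x y) (at x) \<and>
        (v x has_real_derivative vy x y) (at y) \<and>
        (vy x has_real_derivative vyy x y) (at y) \<and>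
        \<epsilon>\<^sup>2 * vxx x y + vyy x y = - 1)"

text \<open>
  The case \<open>\<sigma> = 1\<close> is about supersolutions, \<open>\<sigma> = -1\<close> about subsolutions. The expression in \<open>super\<close>
  is \<open>\<sigma> (V\<^sub>y\<^sub>y + \<epsilon>\<^sup>2 V\<^sub>x\<^sub>x + 1) / \<epsilon>\<^sup>2\<close> for \<open>V = v0 (1 + \<epsilon>\<^sup>2 G)\<close>.
\<close>
lemma comparison:
  fixes v :: "real \<Rightarrow> real \<Rightarrow> real" and \<epsilon> \<kappa> r k x0 :: real
  defines "G \<equiv> \<lambda>x y. \<kappa> + r * y + k * (x - x0)\<^sup>2"
  assumes sol: "rescaled_solution \<epsilon> v" and "\<epsilon> > 0"
    and cd: "a \<le> c" "d \<le> b"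
    and sides: "\<And>y. y \<in> {f1 c..f2 c} \<Longrightarrow> 0 \<le> \<sigma> * (v0 c y * (1 + \<epsilon>\<^sup>2 * G c y) - v c y)"
      "\<And>y. y \<in> {f1 d..f2 d} \<Longrightarrow> 0 \<le> \<sigma> * (v0 d y * (1 + \<epsilon>\<^sup>2 * G d y) - v d y)"
    and super: "\<And>x y. x \<in> {c<..<d} \<Longrightarrow> y \<in> {f1 x<..<f2 x} \<Longrightarrow>
       \<sigma> * (v0xx x y + r * (f1 x + f2 x - 2 * y) - G x y +
         \<epsilon>\<^sup>2 * (v0xx x y * G x y + 4 * k * (x - x0) * v0x x y + 2 * k * v0 x y)) < 0"
    and xy: "x \<in> {c..d}" "y \<in> {f1 x..f2 x}"
  shows "0 \<le> \<sigma> * (v0 x y * (1 + \<epsilon>\<^sup>2 * G x y) - v x y)"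
proof -
  obtain vx vxx vy vyy where v: "\<And>x y. x \<in> {a<..<b} \<Longrightarrow> y \<in> {f1 x<..<f2 x} \<Longrightarrow>
        ((\<lambda>t. v t y) has_real_derivative vx x y) (at x) \<and>
        ((\<lambda>t. vx t y) has_real_derivative vxx x y) (at x) \<and>
        (v x has_real_derivative vy x y) (at y) \<and>
        (vy x has_real_derivative vyy x y) (at y) \<and>
        \<epsilon>\<^sup>2 * vxx x y + vyy x y = - 1"
    and v_cont: "continuous_on (strip a b) (\<lambda>(x, y). v x y)"
    and v_bdry: "\<And>x. x \<in> {a..b} \<Longrightarrow> v x (f1 x) = 0 \<and> v x (f2 x) = 0"
    using sol unfolding rescaled_solution_def by blast
  \<comment> \<open>The partial derivatives of \<open>\<sigma>\<close> times the difference of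
    barrier and solution. \<open>G\<close> contributes \<open>2 * k * (x - x0)\<close> in the
    \<open>x\<close> direction and \<open>r\<close> in the \<open>y\<close> direction.\<close>
  define wx where "wx x y = \<sigma> * (v0x x y * (1 + \<epsilon>\<^sup>2 * G x y) +
      v0 x y * (\<epsilon>\<^sup>2 * (2 * k * (x - x0))) - vx x y)" for x y
  define wxx where "wxx x y = \<sigma> * (v0xx x y * (1 + \<epsilon>\<^sup>2 * G x y) +
      2 * v0x x y * (\<epsilon>\<^sup>2 * (2 * k * (x - x0))) + v0 x y * (\<epsilon>\<^sup>2 * (2 * k)) - vxx x y)" for x y
  define wy where "wy x y = \<sigma> * ((f1 x + f2 x - 2 * y) / 2 * (1 + \<epsilon>\<^sup>2 * G x y) +
      v0 x y * (\<epsilon>\<^sup>2 * r) - vy x y)" for x y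
  define wyy where "wyy x y = \<sigma> * (- (1 + \<epsilon>\<^sup>2 * G x y) +
      (f1 x + f2 x - 2 * y) * (\<epsilon>\<^sup>2 * r) - vyy x y)" for x y
  show ?thesis
  proof (rule minimum_principle[where w = "\<lambda>x y. \<sigma> * (v0 x y * (1 + \<epsilon>\<^sup>2 * G x y) - v x y)"
        and wx = wx and wxx = wxx and wy = wy and wyy = wyy and \<epsilon> = \<epsilon>, OF cd])
    have "continuous_on (strip c d) (\<lambda>p. \<sigma> * (v0 (fst p) (snd p) *
        (1 + \<epsilon>\<^sup>2 * G (fst p) (snd p)) - (\<lambda>(x, y). v x y) p))"
      unfolding G_def
      by (intro continuous_intros continuous_on_subset[OF cont_v0(1)]
          continuous_on_subset[OF v_cont] strip_mono cd)
    then show "continuous_on (strip c d)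
        (\<lambda>(x, y). \<sigma> * (v0 x y * (1 + \<epsilon>\<^sup>2 * G x y) - v x y))"
      by (simp add: case_prod_beta)
  next
    fix x y assume x: "x \<in> {c<..<d}" and y: "y \<in> {f1 x<..<f2 x}"
    have x': "x \<in> {a<..<b}" using x cd by auto
    note V = v[OF x' y]
    \<comment> \<open>Since \<open>v0\<close> has second \<open>y\<close> derivative
      \<open>-1\<close> and \<open>v\<close> solves the equation with right-hand side
      \<open>-1\<close>, the terms of order zero cancel and all others carry the factor
      \<open>\<epsilon>\<^sup>2\<close>.\<close>
    have "\<epsilon>\<^sup>2 * wxx x y + wyy x y = \<epsilon>\<^sup>2 * (\<sigma> * (v0xx x y + r * (f1 x + f2 x - 2 * y) - G x y +
         \<epsilon>\<^sup>2 * (v0xx x y * G x y + 4 * k * (x - x0) * v0x x y + 2 * k * v0 x y)))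
         - \<sigma> * (1 + (\<epsilon>\<^sup>2 * vxx x y + vyy x y))"
      by (simp add: wxx_def wyy_def algebra_simps)
    also have "\<dots> < 0" using super[OF x y] V \<open>\<epsilon> > 0\<close> by (simp add: mult_pos_neg)
    finally have "\<epsilon>\<^sup>2 * wxx x y + wyy x y < 0" .
    then show "((\<lambda>t. \<sigma> * (v0 t y * (1 + \<epsilon>\<^sup>2 * G t y) - v t y)) has_real_derivative wx x y) (at x) \<and>
        ((\<lambda>t. wx t y) has_real_derivative wxx x y) (at x) \<and>
        ((\<lambda>y. \<sigma> * (v0 x y * (1 + \<epsilon>\<^sup>2 * G x y) - v x y)) has_real_derivative wy x y) (at y) \<and>
        (wy x has_real_derivative wyy x y) (at y) \<and>
        \<epsilon>\<^sup>2 * wxx x y + wyy x y < 0"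
      unfolding wx_def wxx_def wy_def wyy_def G_def using V
      by (auto intro!: derivative_eq_intros v0_deriv[OF x'] simp: field_simps power2_eq_square)
  qed (use sides xy cd v_bdry in \<open>auto simp: v0_def\<close>)
qed

section \<open>Approximation of rescaled solutions, globally and then near one abscissa\<close>

lemma bounded_on_strip:
  assumes "continuous_on (strip a b) (\<lambda>p. h (fst p) (snd p) :: real)"
  obtains M where "M > 0" "\<And>x y. x \<in> {a..b} \<Longrightarrow> y \<in> {f1 x..f2 x} \<Longrightarrow> \<bar>h x y\<bar> \<le> M"
proof -
  have "bounded ((\<lambda>p. h (fst p) (snd p)) ` strip a b)"
    by (intro compact_imp_bounded compact_continuous_image assms compact_strip) auto
  then obtain M where M: "M > 0" "\<And>p. p \<in> strip a b \<Longrightarrow> \<bar>h (fst p) (snd p)\<bar> \<le> M"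
    by (auto simp: bounded_pos)
  show thesis
  proof (rule that)
    show "M > 0" by fact
    show "\<bar>h x y\<bar> \<le> M" if "x \<in> {a..b}" "y \<in> {f1 x..f2 x}" for x y
      using M(2)[of "(x, y)"] that by (simp add: strip_def)
  qed
qed

text \<open>Comparison over the whole interval with \<open>G = C\<close> and \<open>G = - C\<close>.
  The error is relative to \<open>v0\<close>, which vanishes on the graphs, so the estimate passes
  to normal derivatives there. The conjunct \<open>\<epsilon>\<^sup>2 * C < 1\<close> later yields
  the sign of the solution.\<close>

lemma uniform_approximation:
  obtains C \<epsilon>1 where "C > 0" "\<epsilon>1 > 0"
    "\<And>\<epsilon> v x y. 0 < \<epsilon> \<Longrightarrow> \<epsilon> < \<epsilon>1 \<Longrightarrow> rescaled_solution \<epsilon> v \<Longrightarrow> x \<in> {a..b} \<Longrightarrow> y \<in> {f1 x..f2 x}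
       \<Longrightarrow> \<epsilon>\<^sup>2 * C < 1 \<and> \<bar>v x y - v0 x y\<bar> \<le> \<epsilon>\<^sup>2 * C * v0 x y"
proof -
  obtain M where M: "M > 0" "\<And>x y. x \<in> {a..b} \<Longrightarrow> y \<in> {f1 x..f2 x} \<Longrightarrow> \<bar>v0xx x y\<bar> \<le> M"
    by (rule bounded_on_strip[OF cont_v0(3)]) (rule that)
  \<comment> \<open>The barrier leaves a gap \<open>C - M = 1\<close>, and
    \<open>\<epsilon>1\<close> below forces \<open>\<epsilon>\<^sup>2 * C * (1 + M) < 1\<close>.
    This keeps the remaining term \<open>\<epsilon>\<^sup>2 * C * v0xx\<close> inside the gap and
    gives \<open>\<epsilon>\<^sup>2 * C < 1\<close> as well.\<close>
  define C where "C = M + 1"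
  have "C > 0" using M(1) by (simp add: C_def)
  define \<epsilon>1 where "\<epsilon>1 = 1 / ((1 + M) * C)"
  show thesis
  proof (rule that)
    show "C > 0" by fact
    show "\<epsilon>1 > 0" using M(1) \<open>C > 0\<close> by (simp add: \<epsilon>1_def)
    fix \<epsilon> v x y
    assume \<epsilon>: "0 < \<epsilon>" "\<epsilon> < \<epsilon>1" and sol: "rescaled_solution \<epsilon> v"
      and xy: "x \<in> {a..b}" "y \<in> {f1 x..f2 x}"
    have "1 * 1 \<le> (1 + M) * C" using M(1) by (intro mult_mono) (auto simp: C_def)
    then have "\<epsilon>1 \<le> 1" by (simp add: \<epsilon>1_def)
    have pos': "(1 + M) * C > 0" using M(1) \<open>C > 0\<close> by simp
    have "\<epsilon>\<^sup>2 < \<epsilon>1"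
      unfolding power2_eq_square using \<epsilon> \<open>\<epsilon>1 \<le> 1\<close>
      by (smt (verit) mult_left_le)
    then have "\<epsilon>\<^sup>2 * ((1 + M) * C) < 1"
      using pos' by (simp only: \<epsilon>1_def pos_less_divide_eq)
    then have E: "\<epsilon>\<^sup>2 * C + \<epsilon>\<^sup>2 * C * M < 1" by (simp add: algebra_simps)
    have pos: "0 \<le> \<epsilon>\<^sup>2 * C" "0 \<le> \<epsilon>\<^sup>2 * C * M" using M(1) \<open>C > 0\<close> by auto
    \<comment> \<open>Over \<open>a\<close> and \<open>b\<close> the region shrinks to a point, so
      the side conditions of \<open>comparison\<close> concern only the two corners.\<close>
    have "v a (f1 a) = 0" "v b (f1 b) = 0" using sol ab by (auto simp: rescaled_solution_def)
    then have corners: "v a 0 = 0" "v b 0 = 0" by (simp_all add: ends)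
    have "0 \<le> \<sigma> * (v0 x y * (1 + \<epsilon>\<^sup>2 * (\<sigma> * C + 0 * y + 0 * (x - 0)\<^sup>2)) - v x y)"
      if \<sigma>: "\<sigma> \<in> {1, -1}" for \<sigma> :: real
    proof (rule comparison[OF sol \<epsilon>(1), of a b])
      fix x y assume xy: "x \<in> {a<..<b}" "y \<in> {f1 x<..<f2 x}"
      have "\<bar>v0xx x y\<bar> \<le> M" using M(2)[of x y] xy by auto
      moreover from this have "\<epsilon>\<^sup>2 * C * \<bar>v0xx x y\<bar> \<le> \<epsilon>\<^sup>2 * C * M" by (intro mult_left_mono pos)
      moreover have "\<bar>\<epsilon>\<^sup>2 * C * v0xx x y\<bar> = \<epsilon>\<^sup>2 * C * \<bar>v0xx x y\<bar>" using \<open>C > 0\<close> by (simp add: abs_mult)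
      ultimately have "\<bar>v0xx x y\<bar> + \<bar>\<epsilon>\<^sup>2 * C * v0xx x y\<bar> < C" using E pos(1) C_def by linarith
      then show "\<sigma> * (v0xx x y + 0 * (f1 x + f2 x - 2 * y) - (\<sigma> * C + 0 * y + 0 * (x - 0)\<^sup>2) +
        \<epsilon>\<^sup>2 * (v0xx x y * (\<sigma> * C + 0 * y + 0 * (x - 0)\<^sup>2) + 4 * 0 * (x - 0) * v0x x y +
          2 * 0 * v0 x y)) < 0"
        using \<sigma> by (auto simp: algebra_simps)
    qed (use xy corners ends in \<open>auto simp: v0_def\<close>)
    from this[of 1] this[of "-1"] show "\<epsilon>\<^sup>2 * C < 1 \<and> \<bar>v x y - v0 x y\<bar> \<le> \<epsilon>\<^sup>2 * C * v0 x y"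
      using E pos by (auto simp: algebra_simps)
  qed
qed

text \<open>For \<open>G = c + r * y\<close> the leading residue of the barrier is affine in
  \<open>y\<close>. Its coefficient of \<open>y\<close> is \<open>(f1'' + f2'') / 2 - 3 * r\<close>,
  whence the value of \<open>r\<close>, and \<open>c\<close> removes the constant part at
  \<open>z\<close>. Continuity makes the residue small near \<open>z\<close>. The barriers are
  centred at the point \<open>x0\<close> under study rather than at \<open>z\<close>, so the
  quadratic penalty is absent from the estimate at \<open>x0\<close> and the bound is uniform for
  \<open>x0\<close> within \<open>\<delta>\<close> of \<open>z\<close>.\<close>

lemma second_order_approximation:
  fixes z \<eta> :: real
  defines "r \<equiv> (f1'' z + f2'' z) / 6"
  assumes z: "z \<in> {a<..<b}" and "\<eta> > 0"
  obtains c \<delta> \<epsilon>2 where "\<delta> > 0" "\<epsilon>2 > 0"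
    "\<And>\<epsilon> v x y. 0 < \<epsilon> \<Longrightarrow> \<epsilon> < \<epsilon>2 \<Longrightarrow> rescaled_solution \<epsilon> v \<Longrightarrow> \<bar>x - z\<bar> \<le> \<delta> \<Longrightarrow> y \<in> {f1 x..f2 x}
       \<Longrightarrow> \<bar>v x y - v0 x y * (1 + \<epsilon>\<^sup>2 * (c + r * y))\<bar> \<le> 2 * \<eta> * \<epsilon>\<^sup>2 * v0 x y"
proof -
  obtain M1 where M1: "M1 > 0" "\<And>x y. x \<in> {a..b} \<Longrightarrow> y \<in> {f1 x..f2 x} \<Longrightarrow> \<bar>v0 x y\<bar> \<le> M1"
    by (rule bounded_on_strip[OF cont_v0(1)]) (rule that)
  obtain M2 where M2: "M2 > 0" "\<And>x y. x \<in> {a..b} \<Longrightarrow> y \<in> {f1 x..f2 x} \<Longrightarrow> \<bar>v0x x y\<bar> \<le> M2"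
    by (rule bounded_on_strip[OF cont_v0(2)]) (rule that)
  obtain M3 where M3: "M3 > 0" "\<And>x y. x \<in> {a..b} \<Longrightarrow> y \<in> {f1 x..f2 x} \<Longrightarrow> \<bar>v0xx x y\<bar> \<le> M3"
    by (rule bounded_on_strip[OF cont_v0(3)]) (rule that)
  have "continuous_on (strip a b) (\<lambda>p. snd p)" by (intro continuous_intros)
  then obtain Y where Y: "Y > 0" "\<And>x y. x \<in> {a..b} \<Longrightarrow> y \<in> {f1 x..f2 x} \<Longrightarrow> \<bar>y\<bar> \<le> Y"
    by (rule bounded_on_strip[where h = "\<lambda>x y. y"]) (rule that)
  obtain C \<epsilon>1 where C: "C > 0" "\<epsilon>1 > 0"
    "\<And>\<epsilon> v x y. 0 < \<epsilon> \<Longrightarrow> \<epsilon> < \<epsilon>1 \<Longrightarrow> rescaled_solution \<epsilon> v \<Longrightarrow> x \<in> {a..b} \<Longrightarrow> y \<in> {f1 x..f2 x}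
       \<Longrightarrow> \<epsilon>\<^sup>2 * C < 1 \<and> \<bar>v x y - v0 x y\<bar> \<le> \<epsilon>\<^sup>2 * C * v0 x y"
    by (rule uniform_approximation) (rule that)
  \<comment> \<open>\<open>\<alpha>\<close> is the part of \<open>v0xx\<close> free of
    \<open>y\<close>. The residue is \<open>A x + B x * y\<close>, and \<open>c\<close> and
    \<open>r\<close> make both coefficients vanish at \<open>z\<close>.\<close>
  define \<alpha> where "\<alpha> x = - (f1 x * f2'' x + 2 * f1' x * f2' x + f1'' x * f2 x) / 2" for x
  define c where "c = \<alpha> z + r * (f1 z + f2 z)"
  define A where "A x = \<alpha> x + r * (f1 x + f2 x) - c" for x
  define B where "B x = (f1'' x + f2'' x) / 2 - 3 * r" for x
  have residue: "v0xx x y + r * (f1 x + f2 x - 2 * y) - (c + r * y) = A x + B x * y" for x y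
    by (simp add: v0xx_def A_def B_def \<alpha>_def field_simps)
  have "A z = 0" "B z = 0" by (simp_all add: A_def B_def c_def r_def)
  \<comment> \<open>As heights are bounded by \<open>Y\<close>, this function dominates the residue
    uniformly in \<open>y\<close>, and it vanishes at \<open>z\<close>.\<close>
  have "continuous_on {a..b} (\<lambda>x. \<bar>A x\<bar> + Y * \<bar>B x\<bar>)"
    unfolding A_def B_def \<alpha>_def by (auto intro!: continuous_intros cont f1'' f2'')
  then obtain \<delta>0 where "\<delta>0 > 0"
    "\<And>x. x \<in> {a..b} \<Longrightarrow> dist x z < \<delta>0 \<Longrightarrow> dist (\<bar>A x\<bar> + Y * \<bar>B x\<bar>) (\<bar>A z\<bar> + Y * \<bar>B z\<bar>) < \<eta>"
    unfolding continuous_on_iff using z \<open>\<eta> > 0\<close> by (metis atLeastAtMost_iff greaterThanLessThan_iff less_imp_le)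
  then have \<delta>0: "\<delta>0 > 0" "\<And>x. x \<in> {a..b} \<Longrightarrow> \<bar>x - z\<bar> < \<delta>0 \<Longrightarrow> \<bar>A x\<bar> + Y * \<bar>B x\<bar> < \<eta>"
    by (force simp: dist_real_def \<open>A z = 0\<close> \<open>B z = 0\<close>)+
  \<comment> \<open>Two displacements of at most \<open>\<delta>\<close>, from \<open>z\<close> to
    \<open>x0\<close> and from \<open>x0\<close> to \<open>x\<close>, must stay inside
    \<open>{a..b}\<close> and within distance \<open>\<delta>0\<close> of \<open>z\<close>; thirds
    leave room for strictness.\<close>
  define \<delta> where "\<delta> = min (\<delta>0 / 3) (min ((z - a) / 3) ((b - z) / 3))"
  have \<delta>: "\<delta> > 0" "3 * \<delta> \<le> \<delta>0" "3 * \<delta> \<le> z - a" "3 * \<delta> \<le> b - z"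
    using \<delta>0(1) z by (auto simp: \<delta>_def min_def)
  define K where "K = (C + \<bar>c\<bar> + \<bar>r\<bar> * Y) / \<delta>\<^sup>2"
  have "K > 0" using C(1) Y(1) \<delta>(1) by (auto simp: K_def intro!: divide_pos_pos add_pos_nonneg)
  have K\<delta>: "K * \<delta>\<^sup>2 = C + \<bar>c\<bar> + \<bar>r\<bar> * Y" using \<delta>(1) by (simp add: K_def)
  \<comment> \<open>\<open>N\<close> bounds the factor \<open>?G\<close> over the short strip and
    \<open>N'\<close> bounds the coefficient of \<open>\<epsilon>\<^sup>2\<close> in the residue, so
    \<open>\<epsilon>2\<close> makes the latter contribution less than
    \<open>\<eta>\<close>.\<close>
  define N where "N = \<bar>c\<bar> + 2 * \<eta> + \<bar>r\<bar> * Y + K * \<delta>\<^sup>2"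
  define N' where "N' = M3 * N + 4 * K * \<delta> * M2 + 2 * K * M1"
  have "0 \<le> \<bar>r\<bar> * Y" "0 \<le> K * \<delta>\<^sup>2" using Y(1) \<open>K > 0\<close> by auto
  then have "N > 0" using \<open>\<eta> > 0\<close> by (simp add: N_def)
  then have "N' > 0" using M1 M2 M3 \<open>K > 0\<close> \<delta>(1) by (simp add: N'_def add_pos_pos)
  define \<epsilon>2 where "\<epsilon>2 = min \<epsilon>1 (min 1 (\<eta> / N'))"
  show thesis
  proof (rule that)
    show "\<delta> > 0" by fact
    show "\<epsilon>2 > 0" using C(2) \<open>\<eta> > 0\<close> \<open>N' > 0\<close> by (simp add: \<epsilon>2_def)
    fix \<epsilon> v x0 y0
    assume \<epsilon>: "0 < \<epsilon>" "\<epsilon> < \<epsilon>2" and sol: "rescaled_solution \<epsilon> v"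
      and x0: "\<bar>x0 - z\<bar> \<le> \<delta>" and y0: "y0 \<in> {f1 x0..f2 x0}"
    have "\<epsilon> < \<epsilon>1" "\<epsilon> < 1" "\<epsilon> < \<eta> / N'" using \<epsilon> by (auto simp: \<epsilon>2_def)
    have "\<epsilon>\<^sup>2 < \<eta> / N'"
      unfolding power2_eq_square using \<epsilon>(1) \<open>\<epsilon> < 1\<close> \<open>\<epsilon> < \<eta> / N'\<close> by (smt (verit) mult_left_le)
    then have \<epsilon>N': "\<epsilon>\<^sup>2 * N' < \<eta>" using \<open>N' > 0\<close> by (simp add: field_simps)
    \<comment> \<open>\<open>K\<close> is chosen so large that the quadratic term beats the global bound \<open>C\<close> on the sides
      \<open>x = x0 \<plusminus> \<delta>\<close>; at \<open>x = x0\<close> itself it vanishes.\<close>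
    let ?G = "\<lambda>\<sigma> x y. c + \<sigma> * (2 * \<eta>) + r * y + \<sigma> * K * (x - x0)\<^sup>2"
    have rY: "\<bar>r * y\<bar> \<le> \<bar>r\<bar> * Y" if "x \<in> {a..b}" "y \<in> {f1 x..f2 x}" for x y
      using Y(2)[OF that] by (simp add: abs_mult mult_left_mono)
    have "0 \<le> \<sigma> * (v0 x0 y0 * (1 + \<epsilon>\<^sup>2 * ?G \<sigma> x0 y0) - v x0 y0)"
      if \<sigma>: "\<sigma> \<in> {1, -1}" for \<sigma> :: real
    proof (rule comparison[OF sol \<epsilon>(1), of "x0 - \<delta>" "x0 + \<delta>"])
      have side: "0 \<le> \<sigma> * (v0 x y * (1 + \<epsilon>\<^sup>2 * ?G \<sigma> x y) - v x y)"
        if "(x - x0)\<^sup>2 = \<delta>\<^sup>2" "x \<in> {a..b}" "y \<in> {f1 x..f2 x}" for x y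
      proof -
        have "\<bar>v x y - v0 x y\<bar> \<le> \<epsilon>\<^sup>2 * C * v0 x y"
          using C(3)[OF \<epsilon>(1) \<open>\<epsilon> < \<epsilon>1\<close> sol] that by auto
        moreover have "C \<le> \<sigma> * ?G \<sigma> x y"
        proof -
          have "\<sigma> * ?G \<sigma> x y = \<sigma> * c + \<sigma> * (r * y) + 2 * \<eta> + (C + \<bar>c\<bar> + \<bar>r\<bar> * Y)"
            unfolding that(1) K\<delta>[symmetric] using \<sigma> by (elim insertE emptyE; simp add: algebra_simps)
          moreover have "\<bar>\<sigma> * c\<bar> = \<bar>c\<bar>" "\<bar>\<sigma> * (r * y)\<bar> = \<bar>r * y\<bar>" using \<sigma> by auto
          ultimately show ?thesis using rY[OF that(2,3)] \<open>\<eta> > 0\<close> by linarith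
        qed
        then have "\<epsilon>\<^sup>2 * v0 x y * C \<le> \<epsilon>\<^sup>2 * v0 x y * (\<sigma> * ?G \<sigma> x y)"
          using v0_nonneg[OF that(3)] by (intro mult_left_mono) auto
        ultimately have "\<bar>v x y - v0 x y\<bar> \<le> \<epsilon>\<^sup>2 * v0 x y * (\<sigma> * ?G \<sigma> x y)" by (simp add: mult_ac)
        moreover have "\<sigma> * (v0 x y - v x y) \<ge> - \<bar>v x y - v0 x y\<bar>"
          using \<sigma> by (elim insertE emptyE; simp)
        moreover have "\<sigma> * (v0 x y * (1 + \<epsilon>\<^sup>2 * ?G \<sigma> x y) - v x y)
            = \<sigma> * (v0 x y - v x y) + \<epsilon>\<^sup>2 * v0 x y * (\<sigma> * ?G \<sigma> x y)" by (simp add: algebra_simps)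
        ultimately show ?thesis by linarith
      qed
      show "0 \<le> \<sigma> * (v0 (x0 - \<delta>) y * (1 + \<epsilon>\<^sup>2 * ?G \<sigma> (x0 - \<delta>) y) - v (x0 - \<delta>) y)"
        if "y \<in> {f1 (x0 - \<delta>)..f2 (x0 - \<delta>)}" for y
        by (rule side) (use that x0 \<delta> in \<open>simp_all add: abs_le_iff\<close>)
      show "0 \<le> \<sigma> * (v0 (x0 + \<delta>) y * (1 + \<epsilon>\<^sup>2 * ?G \<sigma> (x0 + \<delta>) y) - v (x0 + \<delta>) y)"
        if "y \<in> {f1 (x0 + \<delta>)..f2 (x0 + \<delta>)}" for y
        by (rule side) (use that x0 \<delta> in \<open>simp_all add: abs_le_iff\<close>)
    next
      fix x y assume x: "x \<in> {x0 - \<delta><..<x0 + \<delta>}" and y: "y \<in> {f1 x<..<f2 x}"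
      have xy: "x \<in> {a..b}" "y \<in> {f1 x..f2 x}" using x y x0 \<delta> by (simp_all add: abs_le_iff)
      let ?G = "?G \<sigma> x y"
      let ?R = "v0xx x y * ?G + 4 * (\<sigma> * K) * (x - x0) * v0x x y + 2 * (\<sigma> * K) * v0 x y"
      have x': "x0 - \<delta> < x" "x < x0 + \<delta>" using x by auto
      then have "\<bar>x - z\<bar> < \<delta>0" using x0 \<delta>(1,2) by linarith
      then have "\<bar>A x\<bar> + Y * \<bar>B x\<bar> < \<eta>" using \<delta>0(2) xy(1) by blast
      moreover have "\<bar>B x * y\<bar> \<le> Y * \<bar>B x\<bar>"
        unfolding abs_mult using mult_left_mono[OF Y(2)[OF xy], of "\<bar>B x\<bar>"] by (simp add: mult.commute)
      ultimately have small: "\<bar>A x + B x * y\<bar> < \<eta>"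
        using abs_triangle_ineq[of "A x" "B x * y"] by linarith
      have dx: "\<bar>x - x0\<bar> \<le> \<delta>" using x' by linarith
      then have sq: "(x - x0)\<^sup>2 \<le> \<delta>\<^sup>2" using \<delta>(1) by (metis abs_le_square_iff abs_of_pos)
      have \<sigma>K: "\<bar>\<sigma> * K\<bar> = K" using \<sigma> \<open>K > 0\<close> by auto
      have "\<bar>\<sigma> * K * (x - x0)\<^sup>2\<bar> \<le> K * \<delta>\<^sup>2"
        using sq \<open>K > 0\<close> by (simp add: abs_mult[of _ "(x - x0)\<^sup>2"] \<sigma>K)
      moreover have "\<bar>\<sigma> * (2 * \<eta>)\<bar> = 2 * \<eta>" using \<sigma> \<open>\<eta> > 0\<close> by auto
      ultimately have "\<bar>?G\<bar> \<le> N" unfolding N_def using rY[OF xy] by linarith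
      then have "\<bar>v0xx x y * ?G\<bar> \<le> M3 * N"
        unfolding abs_mult using M3(1) M3(2)[OF xy] by (intro mult_mono) simp_all
      moreover have "\<bar>4 * (\<sigma> * K) * (x - x0) * v0x x y\<bar> \<le> 4 * K * \<delta> * M2"
      proof -
        have "\<bar>4 * (\<sigma> * K) * (x - x0) * v0x x y\<bar> = 4 * K * \<bar>x - x0\<bar> * \<bar>v0x x y\<bar>"
          unfolding abs_mult[of _ "v0x x y"] abs_mult[of _ "x - x0"] abs_mult[of 4] \<sigma>K by simp
        also have "\<dots> \<le> 4 * K * \<delta> * M2"
          using M2(1) M2(2)[OF xy] dx \<open>K > 0\<close> \<delta>(1) by (intro mult_mono) simp_all
        finally show ?thesis .
      qed
      moreover have "\<bar>2 * (\<sigma> * K) * v0 x y\<bar> \<le> 2 * K * M1"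
      proof -
        have "\<bar>2 * (\<sigma> * K) * v0 x y\<bar> = 2 * K * \<bar>v0 x y\<bar>"
          unfolding abs_mult[of _ "v0 x y"] abs_mult[of 2] \<sigma>K by simp
        also have "\<dots> \<le> 2 * K * M1"
          using M1(2)[OF xy] \<open>K > 0\<close> by (intro mult_mono) simp_all
        finally show ?thesis .
      qed
      ultimately have "\<bar>?R\<bar> \<le> N'" unfolding N'_def by linarith
      then have "\<epsilon>\<^sup>2 * \<bar>?R\<bar> \<le> \<epsilon>\<^sup>2 * N'" by (intro mult_left_mono) auto
      then have R: "\<bar>\<epsilon>\<^sup>2 * ?R\<bar> < \<eta>" using \<epsilon>N' by (simp add: abs_mult)
      have Kx: "0 \<le> K * (x - x0)\<^sup>2" using \<open>K > 0\<close> by simp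
      \<comment> \<open>As \<open>\<sigma> * \<sigma> = 1\<close>, the barrier supplies
        \<open>-2 * \<eta>\<close> for either sign, and the two error terms, each below
        \<open>\<eta>\<close> in absolute value, cannot use it up.\<close>
      have "\<sigma> * (v0xx x y + r * (f1 x + f2 x - 2 * y) - ?G + \<epsilon>\<^sup>2 * ?R)
          = \<sigma> * (A x + B x * y + \<epsilon>\<^sup>2 * ?R) - \<sigma> * \<sigma> * (2 * \<eta> + K * (x - x0)\<^sup>2)"
        unfolding residue[symmetric] by (simp add: algebra_simps)
      also have "\<dots> < 0"
      proof -
        have "\<sigma> * (A x + B x * y + \<epsilon>\<^sup>2 * ?R) \<le> \<bar>A x + B x * y + \<epsilon>\<^sup>2 * ?R\<bar>"
          using \<sigma> by (elim insertE emptyE; simp only: mult_1 mult_minus1 abs_ge_self abs_ge_minus_self)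
        moreover have "\<sigma> * \<sigma> * (2 * \<eta> + K * (x - x0)\<^sup>2) = 2 * \<eta> + K * (x - x0)\<^sup>2"
          using \<sigma> by (elim insertE emptyE; simp)
        ultimately show ?thesis 
          using abs_triangle_ineq[of "A x + B x * y" "\<epsilon>\<^sup>2 * ?R"] small R Kx by linarith
      qed
      finally show "\<sigma> * (v0xx x y + r * (f1 x + f2 x - 2 * y) - ?G + \<epsilon>\<^sup>2 * ?R) < 0" .
    qed (use x0 \<delta> y0 in auto)
    from this[of 1] this[of "-1"]
    have "0 \<le> v0 x0 y0 * (1 + \<epsilon>\<^sup>2 * (c + 2 * \<eta> + r * y0)) - v x0 y0"
      "v0 x0 y0 * (1 + \<epsilon>\<^sup>2 * (c - 2 * \<eta> + r * y0)) - v x0 y0 \<le> 0" by simp_all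
    then show "\<bar>v x0 y0 - v0 x0 y0 * (1 + \<epsilon>\<^sup>2 * (c + r * y0))\<bar> \<le> 2 * \<eta> * \<epsilon>\<^sup>2 * v0 x0 y0"
      by (intro abs_leI; simp add: algebra_simps)
  qed
qed

end

section \<open>Gradients, difference quotients along rays, and normal directions\<close>

lemma gradient_eq:
  assumes "GDERIV u p :> D"
  shows "gradient u p = D"
  unfolding gradient_def
proof (rule the_equality)
  show "D' = D" if "GDERIV u p :> D'" for D'
  proof -
    have "(\<lambda>h. h \<bullet> D') = (\<lambda>h. h \<bullet> D)"
      using has_derivative_unique assms that unfolding gderiv_def by blast
    then show ?thesis by (metis inner_commute vector_eq_ldot)
  qed
qed fact

lemma gradient_works:
  fixes u :: "'a::euclidean_space \<Rightarrow> real"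
  assumes "GDERIV u p :> D"
  shows "(u has_derivative (\<lambda>h. h \<bullet> gradient u p)) (at p)"
  using assms gradient_eq[OF assms] by (simp add: gderiv_def)

lemma laplacian_plane:
  fixes u :: "real \<times> real \<Rightarrow> real"
  shows "laplacian u p = fst (frechet_derivative (gradient u) (at p) (1, 0)) +
    snd (frechet_derivative (gradient u) (at p) (0, 1))"
proof -
  have "(1::real, 0::real) \<noteq> (0, 1)" by simp
  then show ?thesis unfolding laplacian_def
    by (simp add: Basis_prod_def inner_prod_def)
qed

text \<open>Differentiability is available only inside \<open>\<Omega>\<close>, so the quotient at
  \<open>p\<close> is treated by L'Hopital's rule along the ray. The derivative there is the inner
  product of \<open>g\<close> with \<open>\<nu>\<close>, and \<open>g\<close> is continuous up to
  \<open>p\<close>.\<close>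

lemma directional_limit:
  fixes u :: "'a::euclidean_space \<Rightarrow> real"
  assumes u: "continuous_on S u" and g: "continuous_on S g"
    and deriv: "\<And>q. q \<in> \<Omega> \<Longrightarrow> GDERIV u q :> g q" and "\<Omega> \<subseteq> S"
    and p: "p \<in> S" "u p = 0"
    and ray: "eventually (\<lambda>t. p + t *\<^sub>R \<nu> \<in> \<Omega>) (at_right 0)"
  shows "((\<lambda>t. u (p + t *\<^sub>R \<nu>) / t) \<longlongrightarrow> g p \<bullet> \<nu>) (at_right 0)"
proof -
  have ray': "filterlim (\<lambda>t. p + t *\<^sub>R \<nu>) (at p within S) (at_right 0)" if "\<nu> \<noteq> 0"
  proof -
    have "((\<lambda>t. p + t *\<^sub>R \<nu>) \<longlongrightarrow> p + 0 *\<^sub>R \<nu>) (at_right 0)" by (intro tendsto_intros)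
    moreover have "eventually (\<lambda>t::real. t > 0) (at_right 0)" by (rule eventually_at_right_less)
    with ray have "eventually (\<lambda>t. p + t *\<^sub>R \<nu> \<in> S \<and> p + t *\<^sub>R \<nu> \<noteq> p) (at_right 0)"
      by eventually_elim (use \<open>\<Omega> \<subseteq> S\<close> that in auto)
    ultimately show ?thesis by (simp add: filterlim_at)
  qed
  \<comment> \<open>For \<open>\<nu> = 0\<close> the ray never leaves \<open>p\<close>, so the
    punctured filter at \<open>p\<close> is of no use and the claim is a constant limit.\<close>
  have lim: "((\<lambda>t. h (p + t *\<^sub>R \<nu>)) \<longlongrightarrow> h p) (at_right 0)" if "continuous_on S h" for h :: "'a \<Rightarrow> 'b::topological_space"
  proof (cases "\<nu> = 0")
    case False
    have "(h \<longlongrightarrow> h p) (at p within S)" using that p(1) by (auto simp: continuous_on_def)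
    then show ?thesis using ray'[OF False] by (rule filterlim_compose)
  qed simp
  have num: "((\<lambda>t. u (p + t *\<^sub>R \<nu>)) \<longlongrightarrow> 0) (at_right 0)"
    using lim[OF u] p(2) by simp
  have den: "((\<lambda>t::real. t) \<longlongrightarrow> 0) (at_right 0)" by (rule tendsto_ident_at)
  have den_nz: "eventually (\<lambda>t::real. t \<noteq> 0) (at_right 0)"
    using eventually_at_right_less by (rule eventually_mono) auto
  have num_deriv: "eventually (\<lambda>t. ((\<lambda>t. u (p + t *\<^sub>R \<nu>)) has_real_derivative g (p + t *\<^sub>R \<nu>) \<bullet> \<nu>) (at t))
      (at_right 0)"
    using ray
  proof eventually_elim
    case (elim t)
    have "((\<lambda>t. p + t *\<^sub>R \<nu>) has_derivative (\<lambda>s. s *\<^sub>R \<nu>)) (at t)"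
      by (auto intro!: derivative_eq_intros)
    from has_derivative_compose[OF this deriv[OF elim, unfolded gderiv_def]]
    show ?case by (simp add: has_field_derivative_def inner_commute mult.commute[of _ "\<nu> \<bullet> _"] mult_commute_abs)
  qed
  have quot: "((\<lambda>t. g (p + t *\<^sub>R \<nu>) \<bullet> \<nu> / 1) \<longlongrightarrow> g p \<bullet> \<nu>) (at_right 0)"
    using tendsto_inner[OF lim[OF g] tendsto_const] by simp
  show ?thesis
    by (rule lhopital_right_0[OF num den den_nz _ num_deriv _ quot]) simp_all
qed

text \<open>Let \<open>\<tau>\<close> be the part of \<open>g\<close> orthogonal to
  \<open>N\<close>. The vector \<open>s *\<^sub>R N - \<tau>\<close> lies in the open half space for
  every \<open>s > 0\<close>, so the squared norm of \<open>\<tau>\<close> is at most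
  \<open>s * (g \<bullet> N)\<close>, which is arbitrarily small.\<close>

lemma parallel_to_normal:
  fixes g N :: "'a::real_inner"
  assumes "N \<noteq> 0" and half_space: "\<And>\<nu>. N \<bullet> \<nu> > 0 \<Longrightarrow> 0 \<le> g \<bullet> \<nu>"
  obtains l where "l \<ge> 0" "g = l *\<^sub>R N"
proof
  define l where "l = (g \<bullet> N) / (N \<bullet> N)"
  define \<tau> where "\<tau> = g - l *\<^sub>R N"
  have NN: "N \<bullet> N > 0" using assms(1) by simp
  then show "(g \<bullet> N) / (N \<bullet> N) \<ge> 0" using half_space[of N] by simp
  have "N \<bullet> \<tau> = 0" using NN by (simp add: \<tau>_def l_def inner_diff_right inner_commute)
  have "\<tau> \<bullet> \<tau> \<le> 0 + e" if "e > 0" for e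
  proof -
    define s where "s = e / (\<bar>g \<bullet> N\<bar> + 1)"
    have "s > 0" using that by (simp add: s_def add_nonneg_pos)
    then have "0 \<le> g \<bullet> (s *\<^sub>R N - \<tau>)"
      using \<open>N \<bullet> \<tau> = 0\<close> NN by (intro half_space) (simp add: inner_diff_right)
    moreover have "g \<bullet> \<tau> = \<tau> \<bullet> \<tau>"
      using \<open>N \<bullet> \<tau> = 0\<close> by (simp add: \<tau>_def inner_diff_left inner_diff_right algebra_simps inner_commute)
    moreover have "s * (g \<bullet> N) \<le> s * (\<bar>g \<bullet> N\<bar> + 1)" using \<open>s > 0\<close> by (intro mult_left_mono) auto
    moreover have "s * (\<bar>g \<bullet> N\<bar> + 1) = e" by (simp add: s_def add_nonneg_eq_0_iff)
    ultimately show ?thesis by (simp add: inner_diff_right)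
  qed
  then have "\<tau> \<bullet> \<tau> \<le> 0" by (rule field_le_epsilon)
  then have "\<tau> = 0" by (metis inner_ge_zero inner_eq_zero_iff order_antisym)
  then show "g = ((g \<bullet> N) / (N \<bullet> N)) *\<^sub>R N" by (simp add: \<tau>_def l_def)
qed

section \<open>Topology of the thin domains and rescaling of their torsion functions\<close>

context profiles begin

abbreviation \<Omega> :: "real \<Rightarrow> (real \<times> real) set" where
  "\<Omega> \<equiv> thin_domain a b f1 f2"

lemma mem_\<Omega>: "\<epsilon> > 0 \<Longrightarrow> (x, \<epsilon> * y) \<in> \<Omega> \<epsilon> \<longleftrightarrow> x \<in> {a<..<b} \<and> y \<in> {f1 x<..<f2 x}"
  by (auto simp: thin_domain_def)

lemma open_\<Omega>:
  assumes "\<epsilon> > 0"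
  shows "open (\<Omega> \<epsilon>)"
proof -
  have sub: "{a<..<b} \<times> UNIV \<subseteq> {a..b} \<times> (UNIV :: real set)" by auto
  let ?S = "{a<..<b} \<times> (UNIV :: real set)"
  have "continuous_on ?S (\<lambda>p. snd p - \<epsilon> * f1 (fst p))" "continuous_on ?S (\<lambda>p. \<epsilon> * f2 (fst p) - snd p)"
    by (intro continuous_intros continuous_on_fst_comp cont sub)+
  then have "open (?S \<inter> (\<lambda>p. snd p - \<epsilon> * f1 (fst p)) -` {0<..})"
    "open (?S \<inter> (\<lambda>p. \<epsilon> * f2 (fst p) - snd p) -` {0<..})"
    by (intro continuous_open_preimage open_Times; simp)+
  then have "open ((?S \<inter> (\<lambda>p. snd p - \<epsilon> * f1 (fst p)) -` {0<..}) \<inter>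
      (?S \<inter> (\<lambda>p. \<epsilon> * f2 (fst p) - snd p) -` {0<..}))" by (rule open_Int)
  then show ?thesis by (rule back_subst) (auto simp: thin_domain_def)
qed

text \<open>One inclusion holds because the stretched strip is compact and contains the domain. For
  the other, the closed rectangle is the closure of the open one, which the straightening map sends
  into the domain.\<close>

lemma closure_\<Omega>:
  assumes "\<epsilon> > 0"
  shows "closure (\<Omega> \<epsilon>) = (\<lambda>(x, y). (x, \<epsilon> * y)) ` strip a b"
proof
  have "compact ((\<lambda>(x, y). (x, \<epsilon> * y)) ` strip a b)"
    by (intro compact_continuous_image compact_strip) (auto simp: case_prod_beta intro!: continuous_intros)
  moreover have "\<Omega> \<epsilon> \<subseteq> (\<lambda>(x, y). (x, \<epsilon> * y)) ` strip a b"
  proof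
    fix p assume p: "p \<in> \<Omega> \<epsilon>"
    then have "(fst p, snd p / \<epsilon>) \<in> strip a b"
      using assms mem_\<Omega>[OF assms, of "fst p" "snd p / \<epsilon>"] by (auto simp: strip_def)
    then show "p \<in> (\<lambda>(x, y). (x, \<epsilon> * y)) ` strip a b"
      using assms by (intro image_eqI[where x = "(fst p, snd p / \<epsilon>)"]) auto
  qed
  ultimately show "closure (\<Omega> \<epsilon>) \<subseteq> (\<lambda>(x, y). (x, \<epsilon> * y)) ` strip a b"
    by (intro closure_minimal compact_imp_closed)
next
  let ?\<Phi> = "\<lambda>q. (fst q, \<epsilon> * (f1 (fst q) + snd q * (f2 (fst q) - f1 (fst q))))"
  have cl: "closure ({a<..<b} \<times> {0<..<1}) = {a..b} \<times> {0..1::real}"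
    using ab by (simp add: closure_Times closure_greaterThanLessThan)
  have "?\<Phi> ` closure ({a<..<b} \<times> {0<..<1}) \<subseteq> closure (\<Omega> \<epsilon>)"
  proof (rule image_closure_subset)
    show "continuous_on (closure ({a<..<b} \<times> {0<..<1})) ?\<Phi>"
      unfolding cl by (intro continuous_intros continuous_on_fst_comp cont) auto
    have "?\<Phi> (x, s) \<in> \<Omega> \<epsilon>" if "x \<in> {a<..<b}" "s \<in> {0<..<1}" for x s
    proof -
      have "0 < s * (f2 x - f1 x)" "s * (f2 x - f1 x) < 1 * (f2 x - f1 x)"
        using that less[of x] by (auto intro!: mult_strict_right_mono)
      then show ?thesis using that mem_\<Omega>[OF assms] by simp
    qed
    then show "?\<Phi> ` ({a<..<b} \<times> {0<..<1}) \<subseteq> closure (\<Omega> \<epsilon>)" using closure_subset by force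
  qed simp
  then show "(\<lambda>(x, y). (x, \<epsilon> * y)) ` strip a b \<subseteq> closure (\<Omega> \<epsilon>)"
    unfolding cl strip_eq_image[OF order_refl order_refl] by (simp add: image_image case_prod_beta)
qed

lemma mem_closure_\<Omega>:
  assumes "\<epsilon> > 0"
  shows "(x, \<epsilon> * y) \<in> closure (\<Omega> \<epsilon>) \<longleftrightarrow> x \<in> {a..b} \<and> y \<in> {f1 x..f2 x}"
  using assms by (auto simp: closure_\<Omega> strip_def image_iff)

lemma mem_frontier_\<Omega>:
  assumes "\<epsilon> > 0"
  shows "(x, \<epsilon> * y) \<in> frontier (\<Omega> \<epsilon>) \<longleftrightarrow> x \<in> {a..b} \<and> (y = f1 x \<or> y = f2 x)"
  unfolding frontier_def interior_open[OF open_\<Omega>[OF assms]] Diff_iff mem_closure_\<Omega>[OF assms] mem_\<Omega>[OF assms]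
  using le[of x] ends by auto

text \<open>Each boundary point is a limit point of the domain, so the limit that defines
  \<open>boundary_gradient\<close> is unique and equals the value of any continuous extension
  \<open>g\<close> of the gradient.\<close>

lemma torsion_cases:
  assumes "torsion_function (\<Omega> \<epsilon>) u" "\<epsilon> > 0"
  obtains g where "continuous_on (closure (\<Omega> \<epsilon>)) g" "continuous_on (closure (\<Omega> \<epsilon>)) u"
    "\<And>p. p \<in> \<Omega> \<epsilon> \<Longrightarrow> GDERIV u p :> g p"
    "\<And>p. p \<in> frontier (\<Omega> \<epsilon>) \<Longrightarrow> boundary_gradient (\<Omega> \<epsilon>) u p = g p"
    "\<And>p. p \<in> frontier (\<Omega> \<epsilon>) \<Longrightarrow> u p = 0"
proof -
  obtain g where g: "continuous_on (closure (\<Omega> \<epsilon>)) g" "\<And>p. p \<in> \<Omega> \<epsilon> \<Longrightarrow> GDERIV u p :> g p"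
    using assms by (auto simp: torsion_function_def C1_upto_boundary_def)
  have "boundary_gradient (\<Omega> \<epsilon>) u p = g p" if "p \<in> frontier (\<Omega> \<epsilon>)" for p
  proof -
    have p: "p \<in> closure (\<Omega> \<epsilon>)" "p \<notin> \<Omega> \<epsilon>"
      using that interior_open[OF open_\<Omega>[OF assms(2)]] by (auto simp: frontier_def)
    then have "p islimpt \<Omega> \<epsilon>" by (simp add: closure_def)
    then have "\<not> trivial_limit (at p within \<Omega> \<epsilon>)" by (simp add: trivial_limit_within)
    moreover have "(g \<longlongrightarrow> g p) (at p within \<Omega> \<epsilon>)"
      using g(1) p(1) tendsto_within_subset closure_subset unfolding continuous_on_def by blast
    then have "(gradient u \<longlongrightarrow> g p) (at p within \<Omega> \<epsilon>)"
      by (rule Lim_transform_eventually)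
        (auto simp: eventually_at_filter gradient_eq[OF g(2)])
    ultimately show ?thesis unfolding boundary_gradient_def by (rule tendsto_Lim)
  qed
  then show thesis
    using that g assms by (auto simp: torsion_function_def C1_upto_boundary_def)
qed

text \<open>Chain rule along the axes. Every \<open>y\<close> derivative brings a factor
  \<open>\<epsilon>\<close>, so two of them cancel the division by
  \<open>\<epsilon>\<^sup>2\<close>, and \<open>\<epsilon>\<^sup>2 * vxx + vyy\<close> is the
  Laplacian of \<open>u\<close>.\<close>

lemma rescaled_torsion:
  assumes tor: "torsion_function (\<Omega> \<epsilon>) u" and "\<epsilon> > 0"
  shows "rescaled_solution \<epsilon> (\<lambda>x y. u (x, \<epsilon> * y) / \<epsilon>\<^sup>2)"
proof -
  obtain g where g: "continuous_on (closure (\<Omega> \<epsilon>)) g" "continuous_on (closure (\<Omega> \<epsilon>)) u"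
    "\<And>p. p \<in> \<Omega> \<epsilon> \<Longrightarrow> GDERIV u p :> g p" "\<And>p. p \<in> frontier (\<Omega> \<epsilon>) \<Longrightarrow> u p = 0"
    by (rule torsion_cases[OF assms]) (rule that)
  let ?H = "\<lambda>x y. frechet_derivative (gradient u) (at (x, \<epsilon> * y))"
  define vx where "vx x y = fst (gradient u (x, \<epsilon> * y)) / \<epsilon>\<^sup>2" for x y
  define vxx where "vxx x y = fst (?H x y (1, 0)) / \<epsilon>\<^sup>2" for x y
  define vy where "vy x y = snd (gradient u (x, \<epsilon> * y)) / \<epsilon>" for x y
  define vyy where "vyy x y = snd (?H x y (0, 1))" for x y
  have derivs: "((\<lambda>t. u (t, \<epsilon> * y) / \<epsilon>\<^sup>2) has_real_derivative vx x y) (at x) \<and>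
        ((\<lambda>t. vx t y) has_real_derivative vxx x y) (at x) \<and>
        ((\<lambda>y. u (x, \<epsilon> * y) / \<epsilon>\<^sup>2) has_real_derivative vy x y) (at y) \<and>
        (vy x has_real_derivative vyy x y) (at y) \<and>
        \<epsilon>\<^sup>2 * vxx x y + vyy x y = - 1"
    if "x \<in> {a<..<b}" "y \<in> {f1 x<..<f2 x}" for x y
  proof -
    have p: "(x, \<epsilon> * y) \<in> \<Omega> \<epsilon>" using that mem_\<Omega>[OF \<open>\<epsilon> > 0\<close>] by blast
    note G = gradient_works[OF g(3)[OF p]]
    have H: "(gradient u has_derivative ?H x y) (at (x, \<epsilon> * y))"
      using tor p by (auto simp: torsion_function_def C2_inside_def frechet_derivative_works[symmetric])
    interpret H: bounded_linear "?H x y" using H by (rule has_derivative_bounded_linear)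
    have scale: "?H x y (t, 0) = t *\<^sub>R ?H x y (1, 0)" "?H x y (0, t) = t *\<^sub>R ?H x y (0, 1)" for t
      by (simp_all flip: H.scaleR)
    have X: "((\<lambda>t. (t, \<epsilon> * y)) has_derivative (\<lambda>t. (t, 0))) (at x)"
      by (auto intro!: derivative_eq_intros)
    have Y: "((\<lambda>y. (x, \<epsilon> * y)) has_derivative (\<lambda>t. (0, \<epsilon> * t))) (at y)"
      by (auto intro!: derivative_eq_intros)
    have "((\<lambda>t. u (t, \<epsilon> * y)) has_real_derivative fst (gradient u (x, \<epsilon> * y))) (at x)"
      unfolding has_field_derivative_def
      by (rule has_derivative_eq_rhs[OF has_derivative_compose[OF X G]])
        (simp add: inner_prod_def fun_eq_iff)
    moreover have "((\<lambda>y. u (x, \<epsilon> * y)) has_real_derivative \<epsilon> * snd (gradient u (x, \<epsilon> * y))) (at y)"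
      unfolding has_field_derivative_def
      by (rule has_derivative_eq_rhs[OF has_derivative_compose[OF Y G]])
        (simp add: inner_prod_def fun_eq_iff)
    moreover have "((\<lambda>t. fst (gradient u (t, \<epsilon> * y))) has_real_derivative fst (?H x y (1, 0))) (at x)"
      unfolding has_field_derivative_def
    proof (rule has_derivative_eq_rhs[OF has_derivative_fst[OF has_derivative_compose[OF X H]]])
      have "fst (?H x y (t, 0)) = fst (?H x y (1, 0)) * t" for t using scale(1)[of t] by simp
      then show "(\<lambda>t. fst (?H x y (t, 0))) = (*) (fst (?H x y (1, 0)))" by (rule ext)
    qed
    moreover have "((\<lambda>y. snd (gradient u (x, \<epsilon> * y))) has_real_derivative \<epsilon> * snd (?H x y (0, 1))) (at y)"
      unfolding has_field_derivative_def
    proof (rule has_derivative_eq_rhs[OF has_derivative_snd[OF has_derivative_compose[OF Y H]]])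
      have "snd (?H x y (0, \<epsilon> * t)) = \<epsilon> * snd (?H x y (0, 1)) * t" for t
        using scale(2)[of "\<epsilon> * t"] by simp
      then show "(\<lambda>t. snd (?H x y (0, \<epsilon> * t))) = (*) (\<epsilon> * snd (?H x y (0, 1)))" by (rule ext)
    qed
    moreover have "fst (?H x y (1, 0)) + snd (?H x y (0, 1)) = - 1"
      using tor p by (force simp: torsion_function_def laplacian_plane[symmetric])
    ultimately show ?thesis
      unfolding vx_def vxx_def vy_def vyy_def using \<open>\<epsilon> > 0\<close>
      by (auto intro!: derivative_eq_intros simp: power2_eq_square)
  qed
  have cont_v: "continuous_on (strip a b) (\<lambda>p. u ((\<lambda>(x, y). (x, \<epsilon> * y)) p) / \<epsilon>\<^sup>2)"
    using \<open>\<epsilon> > 0\<close> closure_\<Omega>[OF \<open>\<epsilon> > 0\<close>]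
    by (intro continuous_intros continuous_on_compose2[OF g(2)])
      (auto simp: case_prod_beta intro!: continuous_intros)
  have bdry: "u (x, \<epsilon> * f1 x) = 0 \<and> u (x, \<epsilon> * f2 x) = 0" if "x \<in> {a..b}" for x
    using g(4) mem_frontier_\<Omega>[OF \<open>\<epsilon> > 0\<close>] that by blast
  show ?thesis
    unfolding rescaled_solution_def
    using cont_v bdry
    by (intro conjI ballI exI[of _ vx] exI[of _ vxx] exI[of _ vy] exI[of _ vyy] derivs)
      (simp_all add: case_prod_beta)
qed

end

section \<open>Size of the boundary gradient on the two graphs\<close>

lemma eventually_pos_at_right:
  fixes F :: "real \<Rightarrow> real"
  assumes "(F has_real_derivative d) (at 0)" "F 0 > 0 \<or> F 0 = 0 \<and> d > 0"
  shows "eventually (\<lambda>t. 0 < F t) (at_right 0)"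
proof (cases "F 0 > 0")
  case True
  have "(F \<longlongrightarrow> F 0) (at_right 0)"
    using DERIV_isCont[OF assms(1)] by (auto simp: isCont_def intro: tendsto_within_subset)
  then show ?thesis using True by (rule order_tendstoD)
next
  case False
  then have "F 0 = 0" "d > 0" using assms(2) by auto
  with DERIV_pos_inc_right[OF assms(1)] show ?thesis
    by (auto simp: eventually_at_right_field)
qed

text \<open>\<open>P\<close> and \<open>Q\<close> will be the correction factors on the lower and
  upper graph, and the roots are lengths of normal vectors. Raising \<open>s1\<close> by
  \<open>\<eta>\<close> costs at most \<open>e * \<eta>\<close> in the root, hence
  \<open>2 * e * \<eta>\<close> in the product as \<open>Q \<le> 2\<close>, while \<open>P\<close>
  exceeds \<open>Q\<close> by \<open>4 * \<eta> * e\<close>.\<close>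

lemma stretched_product_less:
  fixes P Q :: real
  assumes Q: "0 \<le> Q" "Q \<le> 2" "Q + 4 * \<eta> * e \<le> P" and pos: "e > 0" "\<eta> > 0" "s1 \<ge> 0" "s2 \<le> s1 + \<eta>"
  shows "Q * sqrt (1 + e * s2) < P * sqrt (1 + e * s1)"
proof -
  let ?r = "sqrt (1 + e * s1)"
  have r: "1 \<le> ?r" using pos by simp
  have "e * s2 \<le> e * (s1 + \<eta>)" using pos by (intro mult_left_mono) auto
  moreover have "2 * (e * \<eta>) * 1 \<le> 2 * (e * \<eta>) * ?r" using r pos by (intro mult_left_mono) auto
  moreover have "(?r + e * \<eta>)\<^sup>2 = 1 + e * s1 + 2 * (e * \<eta>) * ?r + (e * \<eta>)\<^sup>2"
    using pos by (simp add: power2_sum)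
  moreover have "0 \<le> (e * \<eta>)\<^sup>2" "0 \<le> e * \<eta>" using pos by auto
  ultimately have "1 + e * s2 \<le> (?r + e * \<eta>)\<^sup>2" by (simp only: ring_distribs)
  then have "sqrt (1 + e * s2) \<le> ?r + e * \<eta>"
    using r pos by (intro real_le_lsqrt) auto
  then have "Q * sqrt (1 + e * s2) \<le> Q * (?r + e * \<eta>)" using Q by (intro mult_left_mono)
  also have "\<dots> \<le> Q * ?r + 2 * (e * \<eta>)"
    using mult_right_mono[OF Q(2), of "e * \<eta>"] pos by (simp add: ring_distribs)
  also have "\<dots> < Q * ?r + 4 * \<eta> * e * ?r"
  proof -
    have "4 * \<eta> * e * 1 \<le> 4 * \<eta> * e * ?r" using r pos by (intro mult_left_mono) auto
    moreover have "2 * (e * \<eta>) < 4 * \<eta> * e * 1" using pos by simp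
    ultimately show ?thesis by linarith
  qed
  also have "\<dots> = (Q + 4 * \<eta> * e) * ?r" by (simp add: ring_distribs)
  also have "\<dots> \<le> P * ?r" using Q r by (intro mult_right_mono) auto
  finally show ?thesis .
qed

context profiles begin

text \<open>\<open>(- \<epsilon> * f1' x, 1)\<close> is an inward normal. Of the four inequalities
  defining the domain, three are strict at \<open>t = 0\<close> and persist; the one against
  \<open>f1\<close> is an equality there, and its derivative in \<open>t\<close> is the given
  positive inner product.\<close>

lemma ray_from_lower_graph:
  assumes x: "x \<in> {a<..<b}" and "\<epsilon> > 0" and \<nu>: "(- \<epsilon> * f1' x, 1) \<bullet> \<nu> > 0"
  shows "eventually (\<lambda>t. (x, \<epsilon> * f1 x) + t *\<^sub>R \<nu> \<in> \<Omega> \<epsilon>) (at_right 0)"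
proof -
  obtain \<nu>1 \<nu>2 where \<nu>12: "\<nu> = (\<nu>1, \<nu>2)" by (cases \<nu>)
  have line: "((\<lambda>t. x + t * \<nu>1) has_real_derivative \<nu>1) (at 0)" by (auto intro!: derivative_eq_intros)
  have D1: "((\<lambda>t. f1 (x + t * \<nu>1)) has_real_derivative f1' x * \<nu>1) (at 0)"
    and D2: "((\<lambda>t. f2 (x + t * \<nu>1)) has_real_derivative f2' x * \<nu>1) (at 0)"
    using DERIV_chain2[OF _ line, of f1] DERIV_chain2[OF _ line, of f2] at_interior[OF x] by auto
  have "eventually (\<lambda>t. 0 < x + t * \<nu>1 - a) (at_right 0)"
    by (rule eventually_pos_at_right) (use x in \<open>auto intro!: derivative_eq_intros\<close>)
  moreover have "eventually (\<lambda>t. 0 < b - (x + t * \<nu>1)) (at_right 0)"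
    by (rule eventually_pos_at_right) (use x in \<open>auto intro!: derivative_eq_intros\<close>)
  moreover have "eventually (\<lambda>t. 0 < \<epsilon> * f1 x + t * \<nu>2 - \<epsilon> * f1 (x + t * \<nu>1)) (at_right 0)"
    by (rule eventually_pos_at_right[where d = "\<nu>2 - \<epsilon> * (f1' x * \<nu>1)"])
      (use \<nu> in \<open>auto intro!: derivative_eq_intros D1 simp: \<nu>12\<close>)
  moreover have "eventually (\<lambda>t. 0 < \<epsilon> * f2 (x + t * \<nu>1) - (\<epsilon> * f1 x + t * \<nu>2)) (at_right 0)"
    by (rule eventually_pos_at_right[where d = "\<epsilon> * (f2' x * \<nu>1) - \<nu>2"])
      (use less[OF x] \<open>\<epsilon> > 0\<close> in \<open>auto intro!: derivative_eq_intros D2\<close>)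
  ultimately show ?thesis by eventually_elim (simp add: thin_domain_def \<nu>12)
qed

text \<open>As on the lower graph, with the inequality against \<open>f2\<close> as the one that
  degenerates at \<open>t = 0\<close>.\<close>

lemma ray_from_upper_graph:
  assumes x: "x \<in> {a<..<b}" and "\<epsilon> > 0" and \<nu>: "(\<epsilon> * f2' x, - 1) \<bullet> \<nu> > 0"
  shows "eventually (\<lambda>t. (x, \<epsilon> * f2 x) + t *\<^sub>R \<nu> \<in> \<Omega> \<epsilon>) (at_right 0)"
proof -
  obtain \<nu>1 \<nu>2 where \<nu>12: "\<nu> = (\<nu>1, \<nu>2)" by (cases \<nu>)
  have line: "((\<lambda>t. x + t * \<nu>1) has_real_derivative \<nu>1) (at 0)" by (auto intro!: derivative_eq_intros)
  have D1: "((\<lambda>t. f1 (x + t * \<nu>1)) has_real_derivative f1' x * \<nu>1) (at 0)"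
    and D2: "((\<lambda>t. f2 (x + t * \<nu>1)) has_real_derivative f2' x * \<nu>1) (at 0)"
    using DERIV_chain2[OF _ line, of f1] DERIV_chain2[OF _ line, of f2] at_interior[OF x] by auto
  have "eventually (\<lambda>t. 0 < x + t * \<nu>1 - a) (at_right 0)"
    by (rule eventually_pos_at_right) (use x in \<open>auto intro!: derivative_eq_intros\<close>)
  moreover have "eventually (\<lambda>t. 0 < b - (x + t * \<nu>1)) (at_right 0)"
    by (rule eventually_pos_at_right) (use x in \<open>auto intro!: derivative_eq_intros\<close>)
  moreover have "eventually (\<lambda>t. 0 < \<epsilon> * f2 x + t * \<nu>2 - \<epsilon> * f1 (x + t * \<nu>1)) (at_right 0)"
    by (rule eventually_pos_at_right[where d = "\<nu>2 - \<epsilon> * (f1' x * \<nu>1)"])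
      (use less[OF x] \<open>\<epsilon> > 0\<close> in \<open>auto intro!: derivative_eq_intros D1\<close>)
  moreover have "eventually (\<lambda>t. 0 < \<epsilon> * f2 (x + t * \<nu>1) - (\<epsilon> * f2 x + t * \<nu>2)) (at_right 0)"
    by (rule eventually_pos_at_right[where d = "\<epsilon> * (f2' x * \<nu>1) - \<nu>2"])
      (use \<nu> in \<open>auto intro!: derivative_eq_intros D2 simp: \<nu>12\<close>)
  ultimately show ?thesis by eventually_elim (simp add: thin_domain_def \<nu>12)
qed

text \<open>As \<open>u\<close> is nonnegative inside and zero at \<open>p\<close>, its difference
  quotients in all inward directions are nonnegative. The gradient at \<open>p\<close> is thus a
  nonnegative multiple of \<open>N\<close>, and one direction \<open>\<nu>0\<close> suffices to
  compute the multiple.\<close>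

lemma boundary_gradient_inward:
  assumes tor: "torsion_function (\<Omega> \<epsilon>) u" and "\<epsilon> > 0"
    and nonneg: "\<And>p. p \<in> \<Omega> \<epsilon> \<Longrightarrow> 0 \<le> u p"
    and p: "p \<in> frontier (\<Omega> \<epsilon>)"
    and "N \<bullet> \<nu>0 > 0" and ray: "\<And>\<nu>. N \<bullet> \<nu> > 0 \<Longrightarrow> eventually (\<lambda>t. p + t *\<^sub>R \<nu> \<in> \<Omega> \<epsilon>) (at_right 0)"
  obtains l where "l \<ge> 0" "boundary_gradient (\<Omega> \<epsilon>) u p = l *\<^sub>R N"
    "((\<lambda>t. u (p + t *\<^sub>R \<nu>0) / t) \<longlongrightarrow> l * (N \<bullet> \<nu>0)) (at_right 0)"
proof -
  obtain g where g: "continuous_on (closure (\<Omega> \<epsilon>)) g" "continuous_on (closure (\<Omega> \<epsilon>)) u"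
    "\<And>p. p \<in> \<Omega> \<epsilon> \<Longrightarrow> GDERIV u p :> g p"
    "boundary_gradient (\<Omega> \<epsilon>) u p = g p" "u p = 0"
    by (rule torsion_cases[OF tor \<open>\<epsilon> > 0\<close>]) (use p that in blast)
  have lim: "((\<lambda>t. u (p + t *\<^sub>R \<nu>) / t) \<longlongrightarrow> g p \<bullet> \<nu>) (at_right 0)" if "N \<bullet> \<nu> > 0" for \<nu>
    using p by (intro directional_limit[OF g(2,1,3) closure_subset _ g(5)] ray that)
      (simp_all add: frontier_def)
  have "0 \<le> g p \<bullet> \<nu>" if "N \<bullet> \<nu> > 0" for \<nu>
  proof (rule tendsto_lowerbound[OF lim[OF that]])
    show "eventually (\<lambda>t. 0 \<le> u (p + t *\<^sub>R \<nu>) / t) (at_right 0)"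
      using ray[OF that] eventually_at_right_less[of 0] by eventually_elim (simp add: nonneg)
  qed simp
  then obtain l where "l \<ge> 0" "g p = l *\<^sub>R N" by (rule parallel_to_normal[rotated 1]) (use \<open>N \<bullet> \<nu>0 > 0\<close> in auto)
  then show thesis using that g(4) lim[OF \<open>N \<bullet> \<nu>0 > 0\<close>] by simp
qed

text \<open>Near the lower graph the barrier vanishes to first order, so dividing by the vertical
  distance bounds the multiple \<open>l\<close> of the normal from below. The square root is the
  length of that normal.\<close>

lemma lower_graph_gradient_ge:
  assumes tor: "torsion_function (\<Omega> \<epsilon>) u" and "\<epsilon> > 0"
    and nonneg: "\<And>p. p \<in> \<Omega> \<epsilon> \<Longrightarrow> 0 \<le> u p"
    and x: "x \<in> {a<..<b}"
    and bound: "\<And>y. y \<in> {f1 x..f2 x} \<Longrightarrow> v0 x y * (A + B * y) \<le> u (x, \<epsilon> * y) / \<epsilon>\<^sup>2"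
  shows "\<epsilon> * (f2 x - f1 x) / 2 * ((A + B * f1 x) * sqrt (1 + \<epsilon>\<^sup>2 * (f1' x)\<^sup>2))
    \<le> norm (boundary_gradient (\<Omega> \<epsilon>) u (x, \<epsilon> * f1 x))"
proof -
  let ?p = "(x, \<epsilon> * f1 x)" and ?N = "(- \<epsilon> * f1' x, 1 :: real)"
  have p: "?p \<in> frontier (\<Omega> \<epsilon>)" using mem_frontier_\<Omega>[OF \<open>\<epsilon> > 0\<close>] x by auto
  have N: "?N \<bullet> (0, 1) > 0" by simp
  obtain l where l: "l \<ge> 0" "boundary_gradient (\<Omega> \<epsilon>) u ?p = l *\<^sub>R ?N"
    "((\<lambda>t. u (?p + t *\<^sub>R (0, 1)) / t) \<longlongrightarrow> l * (?N \<bullet> (0, 1))) (at_right 0)"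
    by (rule boundary_gradient_inward[OF tor \<open>\<epsilon> > 0\<close> nonneg p N ray_from_lower_graph[OF x \<open>\<epsilon> > 0\<close>]])
      (assumption | erule (2) that)+
  have "((\<lambda>t. u (?p + t *\<^sub>R (0, 1)) / t) \<longlongrightarrow> l) (at_right 0)" using l(3) by simp
  moreover have "((\<lambda>t. \<epsilon> * (f2 x - f1 x - t / \<epsilon>) / 2 * (A + B * (f1 x + t / \<epsilon>))) \<longlongrightarrow>
      \<epsilon> * (f2 x - f1 x - 0 / \<epsilon>) / 2 * (A + B * (f1 x + 0 / \<epsilon>))) (at_right 0)"
    using \<open>\<epsilon> > 0\<close> by (intro tendsto_intros) auto
  moreover have "eventually (\<lambda>t. \<epsilon> * (f2 x - f1 x - t / \<epsilon>) / 2 * (A + B * (f1 x + t / \<epsilon>))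
      \<le> u (?p + t *\<^sub>R (0, 1)) / t) (at_right 0)"
  proof -
    have "eventually (\<lambda>t. 0 < \<epsilon> * (f2 x - f1 x) - t) (at_right 0)"
      by (rule eventually_pos_at_right)
        (use less[OF x] \<open>\<epsilon> > 0\<close> in \<open>auto intro!: derivative_eq_intros\<close>)
    then show ?thesis using eventually_at_right_less[of 0]
    proof eventually_elim
      case (elim t)
      \<comment> \<open>A vertical step \<open>t\<close> is a step \<open>t / \<epsilon>\<close> in
        rescaled height. This is the first factor of \<open>v0\<close>, so division by
        \<open>t\<close> leaves one factor \<open>\<epsilon>\<close>.\<close>
      let ?y = "f1 x + t / \<epsilon>"
      have "?y \<in> {f1 x..f2 x}" using elim \<open>\<epsilon> > 0\<close> by (simp add: field_simps)
      from bound[OF this] have "\<epsilon>\<^sup>2 * (v0 x ?y * (A + B * ?y)) / t \<le> u (x, \<epsilon> * ?y) / t"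
        using \<open>\<epsilon> > 0\<close> elim by (intro divide_right_mono) (simp_all add: field_simps)
      moreover have "\<epsilon>\<^sup>2 * (v0 x ?y * (A + B * ?y)) / t
          = \<epsilon> * (f2 x - f1 x - t / \<epsilon>) / 2 * (A + B * ?y)"
        using \<open>\<epsilon> > 0\<close> elim(2) by (simp add: v0_def power2_eq_square diff_diff_eq)
      moreover have "\<epsilon> * ?y = \<epsilon> * f1 x + t" using \<open>\<epsilon> > 0\<close> by (simp add: field_simps)
      ultimately show ?case by simp
    qed
  qed
  ultimately have "\<epsilon> * (f2 x - f1 x) / 2 * (A + B * f1 x) \<le> l"
    by (simp only: div_0 diff_0_right add_0_right) (rule tendsto_le[OF trivial_limit_at_right_real])
  then have "\<epsilon> * (f2 x - f1 x) / 2 * (A + B * f1 x) * sqrt (1 + \<epsilon>\<^sup>2 * (f1' x)\<^sup>2)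
      \<le> l * sqrt (1 + \<epsilon>\<^sup>2 * (f1' x)\<^sup>2)" by (intro mult_right_mono) auto
  moreover have "norm ?N = sqrt (1 + \<epsilon>\<^sup>2 * (f1' x)\<^sup>2)"
    by (simp add: norm_Pair power_mult_distrib add.commute)
  ultimately show ?thesis using l(1) by (simp only: l(2) norm_scaleR abs_of_nonneg mult.assoc)
qed

text \<open>The mirror image with the vertical direction reversed. The inequality is the opposite
  one because the upper graph is to lose the comparison.\<close>

lemma upper_graph_gradient_le:
  assumes tor: "torsion_function (\<Omega> \<epsilon>) u" and "\<epsilon> > 0"
    and nonneg: "\<And>p. p \<in> \<Omega> \<epsilon> \<Longrightarrow> 0 \<le> u p"
    and x: "x \<in> {a<..<b}"
    and bound: "\<And>y. y \<in> {f1 x..f2 x} \<Longrightarrow> u (x, \<epsilon> * y) / \<epsilon>\<^sup>2 \<le> v0 x y * (A + B * y)"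
  shows "norm (boundary_gradient (\<Omega> \<epsilon>) u (x, \<epsilon> * f2 x))
    \<le> \<epsilon> * (f2 x - f1 x) / 2 * ((A + B * f2 x) * sqrt (1 + \<epsilon>\<^sup>2 * (f2' x)\<^sup>2))"
proof -
  let ?p = "(x, \<epsilon> * f2 x)" and ?N = "(\<epsilon> * f2' x, - 1 :: real)"
  have p: "?p \<in> frontier (\<Omega> \<epsilon>)" using mem_frontier_\<Omega>[OF \<open>\<epsilon> > 0\<close>] x by auto
  have N: "?N \<bullet> (0, - 1) > 0" by simp
  obtain l where l: "l \<ge> 0" "boundary_gradient (\<Omega> \<epsilon>) u ?p = l *\<^sub>R ?N"
    "((\<lambda>t. u (?p + t *\<^sub>R (0, - 1)) / t) \<longlongrightarrow> l * (?N \<bullet> (0, - 1))) (at_right 0)"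
    by (rule boundary_gradient_inward[OF tor \<open>\<epsilon> > 0\<close> nonneg p N ray_from_upper_graph[OF x \<open>\<epsilon> > 0\<close>]])
      (assumption | erule (2) that)+
  have "((\<lambda>t. u (?p + t *\<^sub>R (0, - 1)) / t) \<longlongrightarrow> l) (at_right 0)" using l(3) by simp
  moreover have "((\<lambda>t. \<epsilon> * (f2 x - f1 x - t / \<epsilon>) / 2 * (A + B * (f2 x - t / \<epsilon>))) \<longlongrightarrow>
      \<epsilon> * (f2 x - f1 x - 0 / \<epsilon>) / 2 * (A + B * (f2 x - 0 / \<epsilon>))) (at_right 0)"
    using \<open>\<epsilon> > 0\<close> by (intro tendsto_intros) auto
  moreover have "eventually (\<lambda>t. u (?p + t *\<^sub>R (0, - 1)) / t
      \<le> \<epsilon> * (f2 x - f1 x - t / \<epsilon>) / 2 * (A + B * (f2 x - t / \<epsilon>))) (at_right 0)"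
  proof -
    have "eventually (\<lambda>t. 0 < \<epsilon> * (f2 x - f1 x) - t) (at_right 0)"
      by (rule eventually_pos_at_right)
        (use less[OF x] \<open>\<epsilon> > 0\<close> in \<open>auto intro!: derivative_eq_intros\<close>)
    then show ?thesis using eventually_at_right_less[of 0]
    proof eventually_elim
      case (elim t)
      let ?y = "f2 x - t / \<epsilon>"
      have "?y \<in> {f1 x..f2 x}" using elim \<open>\<epsilon> > 0\<close> by (simp add: field_simps)
      from bound[OF this] have "u (x, \<epsilon> * ?y) / t \<le> \<epsilon>\<^sup>2 * (v0 x ?y * (A + B * ?y)) / t"
        using \<open>\<epsilon> > 0\<close> elim by (intro divide_right_mono) (simp_all add: field_simps)
      moreover have "\<epsilon>\<^sup>2 * (v0 x ?y * (A + B * ?y)) / t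
          = \<epsilon> * (f2 x - f1 x - t / \<epsilon>) / 2 * (A + B * ?y)"
      proof -
        have "?y - f1 x = f2 x - f1 x - t / \<epsilon>" by simp
        then show ?thesis using \<open>\<epsilon> > 0\<close> elim(2) by (simp add: v0_def power2_eq_square)
      qed
      moreover have "\<epsilon> * ?y = \<epsilon> * f2 x - t" using \<open>\<epsilon> > 0\<close> by (simp add: field_simps)
      ultimately show ?case by simp
    qed
  qed
  ultimately have "l \<le> \<epsilon> * (f2 x - f1 x) / 2 * (A + B * f2 x)"
    by (simp only: div_0 diff_0_right) (rule tendsto_le[OF trivial_limit_at_right_real])
  then have "l * sqrt (1 + \<epsilon>\<^sup>2 * (f2' x)\<^sup>2)
      \<le> \<epsilon> * (f2 x - f1 x) / 2 * (A + B * f2 x) * sqrt (1 + \<epsilon>\<^sup>2 * (f2' x)\<^sup>2)"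
    by (intro mult_right_mono) auto
  moreover have "norm ?N = sqrt (1 + \<epsilon>\<^sup>2 * (f2' x)\<^sup>2)"
    by (simp add: norm_Pair power_mult_distrib add.commute)
  ultimately show ?thesis using l(1) by (simp only: l(2) norm_scaleR abs_of_nonneg mult.assoc)
qed

section \<open>Comparison of the two graphs near and away from the maximizer of the width, and fail
  points\<close>

lemma rescaled_at:
  assumes "\<epsilon> > 0" "p \<in> \<Omega> \<epsilon>"
  obtains x y where "p = (x, \<epsilon> * y)" "x \<in> {a<..<b}" "y \<in> {f1 x<..<f2 x}"
  using assms mem_\<Omega>[OF assms(1), of "fst p" "snd p / \<epsilon>"] that[of "fst p" "snd p / \<epsilon>"] by simp

text \<open>A relative error below one cannot change the sign of \<open>v0\<close>.\<close>

lemma torsion_nonneg: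
  assumes "\<epsilon> > 0" "\<epsilon>\<^sup>2 * C < 1"
    and close: "\<And>x y. x \<in> {a..b} \<Longrightarrow> y \<in> {f1 x..f2 x} \<Longrightarrow>
      \<bar>u (x, \<epsilon> * y) / \<epsilon>\<^sup>2 - v0 x y\<bar> \<le> \<epsilon>\<^sup>2 * C * v0 x y"
    and "p \<in> \<Omega> \<epsilon>"
  shows "0 \<le> u p"
proof -
  obtain x y where p: "p = (x, \<epsilon> * y)" and xy: "x \<in> {a<..<b}" "y \<in> {f1 x<..<f2 x}"
    by (rule rescaled_at[OF assms(1,4)])
  have "0 \<le> (1 - \<epsilon>\<^sup>2 * C) * v0 x y" using xy v0_nonneg[of y x] assms(2) by auto
  also have "\<dots> = v0 x y - \<epsilon>\<^sup>2 * C * v0 x y" by (simp add: algebra_simps)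
  also have "\<dots> \<le> u (x, \<epsilon> * y) / \<epsilon>\<^sup>2" using close[of x y] xy by auto
  finally show ?thesis using \<open>\<epsilon> > 0\<close> by (simp add: p zero_le_divide_iff)
qed

text \<open>Over the same \<open>x\<close> the leading terms on both graphs share the width
  \<open>f2 x - f1 x\<close>, and the slopes agree at \<open>z\<close>, so the factor
  \<open>1 + \<epsilon>\<^sup>2 * (c + r * y)\<close> decides. As \<open>r < 0\<close>, it is larger
  at the lower height.\<close>

lemma upper_graph_gradient_less_nearby:
  fixes u :: "real \<Rightarrow> real \<times> real \<Rightarrow> real"
  assumes tor: "\<And>\<epsilon>. \<epsilon> > 0 \<Longrightarrow> torsion_function (\<Omega> \<epsilon>) (u \<epsilon>)"
    and z: "z \<in> {a<..<b}" and slopes: "f1' z = f2' z" and bend: "f1'' z + f2'' z < 0"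
  obtains \<delta> \<epsilon>0 where "\<delta> > 0" "\<epsilon>0 > 0"
    "\<And>\<epsilon> x. 0 < \<epsilon> \<Longrightarrow> \<epsilon> < \<epsilon>0 \<Longrightarrow> \<bar>x - z\<bar> < \<delta> \<Longrightarrow>
       norm (boundary_gradient (\<Omega> \<epsilon>) (u \<epsilon>) (x, \<epsilon> * f2 x)) < norm (boundary_gradient (\<Omega> \<epsilon>) (u \<epsilon>) (x, \<epsilon> * f1 x))"
proof -
  define h0 where "h0 = f2 z - f1 z"
  define r where "r = (f1'' z + f2'' z) / 6"
  \<comment> \<open>Near \<open>z\<close> the width exceeds \<open>h0 / 2\<close>, so the lower
    graph gains \<open>8 * \<eta>\<close> at order \<open>\<epsilon>\<^sup>2\<close>. The
    approximation errors in \<open>P\<close> and \<open>Q\<close> cost \<open>2 * \<eta>\<close>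
    each, and what is left is the \<open>4 * \<eta>\<close> that
    \<open>stretched_product_less\<close> asks for.\<close>
  define \<eta> where "\<eta> = - r * h0 / 16"
  have "h0 > 0" using less[OF z] by (simp add: h0_def)
  have "r < 0" using bend by (simp add: r_def)
  have "\<eta> > 0" using \<open>h0 > 0\<close> \<open>r < 0\<close> by (simp add: \<eta>_def mult_neg_pos)
  obtain c \<delta> \<epsilon>2 where second: "\<delta> > 0" "\<epsilon>2 > 0"
    "\<And>\<epsilon> v x y. 0 < \<epsilon> \<Longrightarrow> \<epsilon> < \<epsilon>2 \<Longrightarrow> rescaled_solution \<epsilon> v \<Longrightarrow> \<bar>x - z\<bar> \<le> \<delta> \<Longrightarrow> y \<in> {f1 x..f2 x}
       \<Longrightarrow> \<bar>v x y - v0 x y * (1 + \<epsilon>\<^sup>2 * (c + r * y))\<bar> \<le> 2 * \<eta> * \<epsilon>\<^sup>2 * v0 x y"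
    by (rule second_order_approximation[OF z \<open>\<eta> > 0\<close>, folded r_def]) (rule that)
  obtain C \<epsilon>1 where C: "C > 0" "\<epsilon>1 > 0"
    "\<And>\<epsilon> v x y. 0 < \<epsilon> \<Longrightarrow> \<epsilon> < \<epsilon>1 \<Longrightarrow> rescaled_solution \<epsilon> v \<Longrightarrow> x \<in> {a..b} \<Longrightarrow> y \<in> {f1 x..f2 x}
       \<Longrightarrow> \<epsilon>\<^sup>2 * C < 1 \<and> \<bar>v x y - v0 x y\<bar> \<le> \<epsilon>\<^sup>2 * C * v0 x y"
    by (rule uniform_approximation) (rule that)
  obtain Y where Y: "Y > 0" "\<And>x y. x \<in> {a..b} \<Longrightarrow> y \<in> {f1 x..f2 x} \<Longrightarrow> \<bar>y\<bar> \<le> Y"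
    by (rule bounded_on_strip[where h = "\<lambda>x y. y"]) (auto intro: continuous_intros that)
  have isCont: "isCont f1 z" "isCont f2 z" "isCont f1' z" "isCont f2' z"
    using at_interior[OF z] by (auto intro: DERIV_isCont)
  have "eventually (\<lambda>x. h0 / 2 < f2 x - f1 x) (nhds z)"
  proof (rule order_tendstoD(1)[where y = h0])
    show "((\<lambda>x. f2 x - f1 x) \<longlongrightarrow> h0) (nhds z)"
      unfolding h0_def using isCont by (intro tendsto_intros) (simp_all add: tendsto_at_iff_tendsto_nhds isCont_def)
  qed (use \<open>h0 > 0\<close> in simp)
  \<comment> \<open>The difference is zero at \<open>z\<close> by the equality of slopes; nearby it
    controls how far the lengths of the two normals differ.\<close>
  moreover have "eventually (\<lambda>x. (f2' x)\<^sup>2 - (f1' x)\<^sup>2 < \<eta>) (nhds z)"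
  proof (rule order_tendstoD(2)[where y = "(f2' z)\<^sup>2 - (f1' z)\<^sup>2"])
    show "((\<lambda>x. (f2' x)\<^sup>2 - (f1' x)\<^sup>2) \<longlongrightarrow> (f2' z)\<^sup>2 - (f1' z)\<^sup>2) (nhds z)"
      using isCont by (intro tendsto_intros) (simp_all add: tendsto_at_iff_tendsto_nhds isCont_def)
  qed (use \<open>\<eta> > 0\<close> slopes in simp)
  moreover have "eventually (\<lambda>x. x \<in> {a<..<b}) (nhds z)"
    using z by (intro eventually_nhds_in_open) auto
  ultimately have "eventually (\<lambda>x. h0 / 2 < f2 x - f1 x \<and> (f2' x)\<^sup>2 - (f1' x)\<^sup>2 < \<eta> \<and> x \<in> {a<..<b}) (nhds z)"
    by eventually_elim auto
  then obtain \<delta>' where \<delta>': "\<delta>' > 0"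
    "\<And>x. \<bar>x - z\<bar> < \<delta>' \<Longrightarrow> h0 / 2 < f2 x - f1 x \<and> (f2' x)\<^sup>2 - (f1' x)\<^sup>2 < \<eta> \<and> x \<in> {a<..<b}"
    by (auto simp: eventually_nhds_metric dist_real_def)
  \<comment> \<open>\<open>W\<close> bounds the coefficient of \<open>\<epsilon>\<^sup>2\<close> in
    \<open>Q\<close>, so \<open>\<epsilon>\<^sup>2 * W < 1\<close> puts \<open>Q\<close> between
    \<open>0\<close> and \<open>2\<close>.\<close>
  define W where "W = \<bar>c\<bar> + 2 * \<eta> + \<bar>r\<bar> * Y"
  have "W > 0" using \<open>\<eta> > 0\<close> Y(1) by (auto simp: W_def intro: add_pos_nonneg add_nonneg_pos)
  define \<epsilon>0 where "\<epsilon>0 = min (min \<epsilon>1 \<epsilon>2) (min 1 (1 / W))"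
  show thesis
  proof (rule that)
    show "min \<delta> \<delta>' > 0" using second(1) \<delta>'(1) by simp
    show "\<epsilon>0 > 0" using C(2) second(2) \<open>W > 0\<close> by (simp add: \<epsilon>0_def)
    fix \<epsilon> x assume \<epsilon>: "0 < \<epsilon>" "\<epsilon> < \<epsilon>0" and x: "\<bar>x - z\<bar> < min \<delta> \<delta>'"
    have \<epsilon>': "\<epsilon> < \<epsilon>1" "\<epsilon> < \<epsilon>2" "\<epsilon> < 1" "\<epsilon> < 1 / W" using \<epsilon> by (auto simp: \<epsilon>0_def)
    have "\<epsilon> * \<epsilon> \<le> \<epsilon> * 1" using \<epsilon>(1) \<epsilon>'(3) by (intro mult_left_mono) auto
    then have "\<epsilon>\<^sup>2 < 1 / W" using \<epsilon>'(4) by (simp add: power2_eq_square)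
    then have \<epsilon>W: "\<epsilon>\<^sup>2 * W < 1" using \<open>W > 0\<close> by (simp add: field_simps)
    have near: "h0 / 2 < f2 x - f1 x" "(f2' x)\<^sup>2 \<le> (f1' x)\<^sup>2 + \<eta>" "x \<in> {a<..<b}"
      using \<delta>'(2)[of x] x by auto
    have xab: "x \<in> {a..b}" using near(3) by auto
    note sol = rescaled_torsion[OF tor[OF \<epsilon>(1)] \<epsilon>(1)]
    have "\<epsilon>\<^sup>2 * C < 1" using C(3)[OF \<epsilon>(1) \<epsilon>'(1) sol xab, of "f1 x"] le[OF xab] by auto
    then have nonneg: "0 \<le> u \<epsilon> p" if "p \<in> \<Omega> \<epsilon>" for p
      using C(3)[OF \<epsilon>(1) \<epsilon>'(1) sol] that by (intro torsion_nonneg[OF \<epsilon>(1)]) auto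
    have approx: "\<bar>u \<epsilon> (x, \<epsilon> * y) / \<epsilon>\<^sup>2 - v0 x y * (1 + \<epsilon>\<^sup>2 * (c + r * y))\<bar> \<le> 2 * \<eta> * \<epsilon>\<^sup>2 * v0 x y"
      if "y \<in> {f1 x..f2 x}" for y
      using second(3)[OF \<epsilon>(1) \<epsilon>'(2) sol _ that] x by auto
    \<comment> \<open>Each factor takes the approximation error with its unfavourable sign: low on
      the lower graph, high on the upper.\<close>
    define P where "P = 1 + \<epsilon>\<^sup>2 * (c - 2 * \<eta>) + \<epsilon>\<^sup>2 * r * f1 x"
    define Q where "Q = 1 + \<epsilon>\<^sup>2 * (c + 2 * \<eta>) + \<epsilon>\<^sup>2 * r * f2 x"
    have "Q * sqrt (1 + \<epsilon>\<^sup>2 * (f2' x)\<^sup>2) < P * sqrt (1 + \<epsilon>\<^sup>2 * (f1' x)\<^sup>2)"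
    proof (rule stretched_product_less)
      have "\<bar>r * f2 x\<bar> \<le> \<bar>r\<bar> * Y"
        unfolding abs_mult using Y(2)[OF xab, of "f2 x"] le[OF xab] by (intro mult_left_mono) auto
      then have "\<bar>c + 2 * \<eta> + r * f2 x\<bar> \<le> W" unfolding W_def using \<open>\<eta> > 0\<close> by linarith
      then have "\<epsilon>\<^sup>2 * \<bar>c + 2 * \<eta> + r * f2 x\<bar> \<le> \<epsilon>\<^sup>2 * W" by (intro mult_left_mono) auto
      then have "\<bar>\<epsilon>\<^sup>2 * (c + 2 * \<eta> + r * f2 x)\<bar> < 1" using \<epsilon>W by (simp add: abs_mult)
      moreover have "Q = 1 + \<epsilon>\<^sup>2 * (c + 2 * \<eta> + r * f2 x)" by (simp add: Q_def algebra_simps)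
      ultimately show "0 \<le> Q" "Q \<le> 2" by linarith+
      have "- r * (h0 / 2) \<le> - r * (f2 x - f1 x)" using near(1) \<open>r < 0\<close> by (intro mult_left_mono) auto
      moreover have "8 * \<eta> = - r * (h0 / 2)" by (simp add: \<eta>_def)
      ultimately have "\<epsilon>\<^sup>2 * (8 * \<eta>) \<le> \<epsilon>\<^sup>2 * (- r * (f2 x - f1 x))"
        by (intro mult_left_mono) simp_all
      then show "Q + 4 * \<eta> * \<epsilon>\<^sup>2 \<le> P" by (simp add: P_def Q_def algebra_simps)
    qed (use \<epsilon> \<open>\<eta> > 0\<close> near in auto)
    then have "\<epsilon> * (f2 x - f1 x) / 2 * (Q * sqrt (1 + \<epsilon>\<^sup>2 * (f2' x)\<^sup>2))
        < \<epsilon> * (f2 x - f1 x) / 2 * (P * sqrt (1 + \<epsilon>\<^sup>2 * (f1' x)\<^sup>2))"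
      using less[OF near(3)] \<epsilon>(1) by (intro mult_strict_left_mono) auto
    moreover have "norm (boundary_gradient (\<Omega> \<epsilon>) (u \<epsilon>) (x, \<epsilon> * f2 x))
        \<le> \<epsilon> * (f2 x - f1 x) / 2 * (Q * sqrt (1 + \<epsilon>\<^sup>2 * (f2' x)\<^sup>2))"
      unfolding Q_def
    proof (rule upper_graph_gradient_le[OF tor[OF \<epsilon>(1)] \<epsilon>(1) nonneg near(3)])
      show "u \<epsilon> (x, \<epsilon> * y) / \<epsilon>\<^sup>2 \<le> v0 x y * (1 + \<epsilon>\<^sup>2 * (c + 2 * \<eta>) + \<epsilon>\<^sup>2 * r * y)"
        if "y \<in> {f1 x..f2 x}" for y
      proof -
        have "v0 x y * (1 + \<epsilon>\<^sup>2 * (c + 2 * \<eta>) + \<epsilon>\<^sup>2 * r * y)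
            = v0 x y * (1 + \<epsilon>\<^sup>2 * (c + r * y)) + 2 * \<eta> * \<epsilon>\<^sup>2 * v0 x y" by (simp add: algebra_simps)
        then show ?thesis using approx[OF that] by linarith
      qed
    qed
    moreover have "\<epsilon> * (f2 x - f1 x) / 2 * (P * sqrt (1 + \<epsilon>\<^sup>2 * (f1' x)\<^sup>2))
        \<le> norm (boundary_gradient (\<Omega> \<epsilon>) (u \<epsilon>) (x, \<epsilon> * f1 x))"
      unfolding P_def
    proof (rule lower_graph_gradient_ge[OF tor[OF \<epsilon>(1)] \<epsilon>(1) nonneg near(3)])
      show "v0 x y * (1 + \<epsilon>\<^sup>2 * (c - 2 * \<eta>) + \<epsilon>\<^sup>2 * r * y) \<le> u \<epsilon> (x, \<epsilon> * y) / \<epsilon>\<^sup>2"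
        if "y \<in> {f1 x..f2 x}" for y
      proof -
        have "v0 x y * (1 + \<epsilon>\<^sup>2 * (c - 2 * \<eta>) + \<epsilon>\<^sup>2 * r * y)
            = v0 x y * (1 + \<epsilon>\<^sup>2 * (c + r * y)) - 2 * \<eta> * \<epsilon>\<^sup>2 * v0 x y" by (simp add: algebra_simps)
        then show ?thesis using approx[OF that] by linarith
      qed
    qed
    ultimately show "norm (boundary_gradient (\<Omega> \<epsilon>) (u \<epsilon>) (x, \<epsilon> * f2 x))
        < norm (boundary_gradient (\<Omega> \<epsilon>) (u \<epsilon>) (x, \<epsilon> * f1 x))" by linarith
  qed
qed

text \<open>Away from \<open>z\<close> compactness keeps the width below some \<open>m < h0\<close>,
  so the leading term in \<open>\<epsilon>\<close> already decides and the crude global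
  approximation suffices. The winning point is the one on the lower graph over
  \<open>z\<close>.\<close>

lemma upper_graph_gradient_less_far:
  fixes u :: "real \<Rightarrow> real \<times> real \<Rightarrow> real"
  assumes tor: "\<And>\<epsilon>. \<epsilon> > 0 \<Longrightarrow> torsion_function (\<Omega> \<epsilon>) (u \<epsilon>)"
    and z: "z \<in> {a<..<b}" and max: "\<And>x. x \<in> {a..b} \<Longrightarrow> x \<noteq> z \<Longrightarrow> f2 x - f1 x < f2 z - f1 z"
    and "\<delta> > 0"
  obtains \<epsilon>0 where "\<epsilon>0 > 0"
    "\<And>\<epsilon> x. 0 < \<epsilon> \<Longrightarrow> \<epsilon> < \<epsilon>0 \<Longrightarrow> x \<in> {a<..<b} \<Longrightarrow> \<delta> \<le> \<bar>x - z\<bar> \<Longrightarrow>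
       norm (boundary_gradient (\<Omega> \<epsilon>) (u \<epsilon>) (x, \<epsilon> * f2 x)) < norm (boundary_gradient (\<Omega> \<epsilon>) (u \<epsilon>) (z, \<epsilon> * f1 z))"
proof -
  define h0 where "h0 = f2 z - f1 z"
  have "h0 > 0" using less[OF z] by (simp add: h0_def)
  obtain C \<epsilon>1 where C: "C > 0" "\<epsilon>1 > 0"
    "\<And>\<epsilon> v x y. 0 < \<epsilon> \<Longrightarrow> \<epsilon> < \<epsilon>1 \<Longrightarrow> rescaled_solution \<epsilon> v \<Longrightarrow> x \<in> {a..b} \<Longrightarrow> y \<in> {f1 x..f2 x}
       \<Longrightarrow> \<epsilon>\<^sup>2 * C < 1 \<and> \<bar>v x y - v0 x y\<bar> \<le> \<epsilon>\<^sup>2 * C * v0 x y"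
    by (rule uniform_approximation) (rule that)
  have "bounded (f2' ` {a..b})"
    by (intro compact_imp_bounded compact_continuous_image cont) auto
  then obtain L where L: "L > 0" "\<And>x. x \<in> {a..b} \<Longrightarrow> \<bar>f2' x\<bar> \<le> L" by (auto simp: bounded_pos)
  obtain m where m: "m < h0" "\<And>x. x \<in> {a..b} \<Longrightarrow> \<delta> \<le> \<bar>x - z\<bar> \<Longrightarrow> f2 x - f1 x \<le> m"
  proof (cases "{a..b} - ball z \<delta> = {}")
    \<comment> \<open>No point of the interval is that far from \<open>z\<close>, and any number
      below \<open>h0\<close> serves.\<close>
    case True
    then show thesis using that[of "h0 - 1"] by (force simp: dist_real_def abs_minus_commute)
  next
    case False
    have "compact ({a..b} - ball z \<delta>)" by (intro compact_diff) auto
    moreover have "continuous_on ({a..b} - ball z \<delta>) (\<lambda>x. f2 x - f1 x)"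
      by (intro continuous_intros cont[THEN continuous_on_subset]) auto
    ultimately obtain x1 where x1: "x1 \<in> {a..b} - ball z \<delta>"
      "\<And>x. x \<in> {a..b} - ball z \<delta> \<Longrightarrow> f2 x - f1 x \<le> f2 x1 - f1 x1"
      using continuous_attains_sup[OF _ False] by blast
    have "f2 x1 - f1 x1 < h0"
      unfolding h0_def using x1(1) \<open>\<delta> > 0\<close> by (intro max) auto
    then show thesis using x1(2) by (intro that) (auto simp: dist_real_def abs_minus_commute)
  qed
  \<comment> \<open>At \<open>\<epsilon> = 0\<close> the difference is \<open>h0 - m > 0\<close>, so
    it stays positive for small \<open>\<epsilon>\<close>.\<close>
  have "((\<lambda>\<epsilon>. h0 * (1 - \<epsilon>\<^sup>2 * C) - m * ((1 + \<epsilon>\<^sup>2 * C) * sqrt (1 + \<epsilon>\<^sup>2 * L\<^sup>2))) \<longlongrightarrow>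
      h0 * (1 - 0\<^sup>2 * C) - m * ((1 + 0\<^sup>2 * C) * sqrt (1 + 0\<^sup>2 * L\<^sup>2))) (at_right 0)"
    by (intro tendsto_intros)
  then have "eventually (\<lambda>\<epsilon>. 0 < h0 * (1 - \<epsilon>\<^sup>2 * C) - m * ((1 + \<epsilon>\<^sup>2 * C) * sqrt (1 + \<epsilon>\<^sup>2 * L\<^sup>2)))
      (at_right 0)"
    by (rule order_tendstoD) (use m(1) in simp)
  then obtain \<epsilon>2 where \<epsilon>2: "\<epsilon>2 > 0" "\<And>\<epsilon>. 0 < \<epsilon> \<Longrightarrow> \<epsilon> < \<epsilon>2 \<Longrightarrow>
      m * ((1 + \<epsilon>\<^sup>2 * C) * sqrt (1 + \<epsilon>\<^sup>2 * L\<^sup>2)) < h0 * (1 - \<epsilon>\<^sup>2 * C)"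
    by (auto simp: eventually_at_right_field)
  show thesis
  proof (rule that)
    show "min \<epsilon>1 \<epsilon>2 > 0" using C(2) \<epsilon>2(1) by simp
    fix \<epsilon> x assume \<epsilon>: "0 < \<epsilon>" "\<epsilon> < min \<epsilon>1 \<epsilon>2" and x: "x \<in> {a<..<b}" "\<delta> \<le> \<bar>x - z\<bar>"
    have \<epsilon>': "\<epsilon> < \<epsilon>1" "\<epsilon> < \<epsilon>2" using \<epsilon> by auto
    have xab: "x \<in> {a..b}" and zab: "z \<in> {a..b}" using x z by auto
    note sol = rescaled_torsion[OF tor[OF \<epsilon>(1)] \<epsilon>(1)]
    note approx = C(3)[OF \<epsilon>(1) \<epsilon>'(1) sol]
    have \<epsilon>C: "\<epsilon>\<^sup>2 * C < 1" using approx[OF xab, of "f1 x"] le[OF xab] by auto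
    then have nonneg: "0 \<le> u \<epsilon> p" if "p \<in> \<Omega> \<epsilon>" for p
      using approx that by (intro torsion_nonneg[OF \<epsilon>(1)]) auto
    have "norm (boundary_gradient (\<Omega> \<epsilon>) (u \<epsilon>) (x, \<epsilon> * f2 x))
        \<le> \<epsilon> * (f2 x - f1 x) / 2 * ((1 + \<epsilon>\<^sup>2 * C + 0 * f2 x) * sqrt (1 + \<epsilon>\<^sup>2 * (f2' x)\<^sup>2))"
    proof (rule upper_graph_gradient_le[OF tor[OF \<epsilon>(1)] \<epsilon>(1) nonneg x(1)])
      show "u \<epsilon> (x, \<epsilon> * y) / \<epsilon>\<^sup>2 \<le> v0 x y * (1 + \<epsilon>\<^sup>2 * C + 0 * y)" if "y \<in> {f1 x..f2 x}" for y
        using approx[OF xab that] by (simp add: algebra_simps abs_le_iff)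
    qed
    also have "\<dots> = \<epsilon> / 2 * ((f2 x - f1 x) * ((1 + \<epsilon>\<^sup>2 * C) * sqrt (1 + \<epsilon>\<^sup>2 * (f2' x)\<^sup>2)))" by simp
    also have "\<dots> \<le> \<epsilon> / 2 * (m * ((1 + \<epsilon>\<^sup>2 * C) * sqrt (1 + \<epsilon>\<^sup>2 * L\<^sup>2)))"
    proof -
      have "(f2' x)\<^sup>2 \<le> L\<^sup>2" using L(1) L(2)[OF xab] by (metis abs_le_square_iff abs_of_pos)
      then have "sqrt (1 + \<epsilon>\<^sup>2 * (f2' x)\<^sup>2) \<le> sqrt (1 + \<epsilon>\<^sup>2 * L\<^sup>2)"
        by (auto intro: mult_left_mono)
      moreover have "f2 x - f1 x \<le> m" using m(2)[OF xab x(2)] .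
      moreover have "0 \<le> f2 x - f1 x" using le[OF xab] by simp
      ultimately show ?thesis using \<epsilon>(1) C(1) by (intro mult_mono) auto
    qed
    also have "\<dots> < \<epsilon> / 2 * (h0 * (1 - \<epsilon>\<^sup>2 * C))"
      using \<epsilon>2(2)[OF \<epsilon>(1) \<epsilon>'(2)] \<epsilon>(1) by (intro mult_strict_left_mono) auto
    also have "\<dots> \<le> \<epsilon> * h0 / 2 * ((1 - \<epsilon>\<^sup>2 * C + 0 * f1 z) * sqrt (1 + \<epsilon>\<^sup>2 * (f1' z)\<^sup>2))"
    proof -
      have "(1 - \<epsilon>\<^sup>2 * C) * 1 \<le> (1 - \<epsilon>\<^sup>2 * C) * sqrt (1 + \<epsilon>\<^sup>2 * (f1' z)\<^sup>2)"
        using \<epsilon>C by (intro mult_left_mono) auto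
      then have "\<epsilon> * h0 / 2 * ((1 - \<epsilon>\<^sup>2 * C) * 1)
          \<le> \<epsilon> * h0 / 2 * ((1 - \<epsilon>\<^sup>2 * C) * sqrt (1 + \<epsilon>\<^sup>2 * (f1' z)\<^sup>2))"
        using \<epsilon>(1) \<open>h0 > 0\<close> by - (rule mult_left_mono, simp_all)
      then show ?thesis by (simp add: mult.assoc)
    qed
    also have "\<dots> \<le> norm (boundary_gradient (\<Omega> \<epsilon>) (u \<epsilon>) (z, \<epsilon> * f1 z))"
      unfolding h0_def
    proof (rule lower_graph_gradient_ge[OF tor[OF \<epsilon>(1)] \<epsilon>(1) nonneg z])
      show "v0 z y * (1 - \<epsilon>\<^sup>2 * C + 0 * y) \<le> u \<epsilon> (z, \<epsilon> * y) / \<epsilon>\<^sup>2" if "y \<in> {f1 z..f2 z}" for y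
        using approx[OF zab that] by (simp add: algebra_simps abs_le_iff)
    qed
    finally show "norm (boundary_gradient (\<Omega> \<epsilon>) (u \<epsilon>) (x, \<epsilon> * f2 x))
        < norm (boundary_gradient (\<Omega> \<epsilon>) (u \<epsilon>) (z, \<epsilon> * f1 z))" .
  qed
qed

text \<open>The two corners lie on the lower graph too, so only upper points over the open interval
  have to be beaten.\<close>

lemma fail_points_subset_lower_graph:
  assumes "\<epsilon> > 0"
    and less_somewhere: "\<And>x. x \<in> {a<..<b} \<Longrightarrow> \<exists>x'\<in>{a..b}.
      norm (boundary_gradient (\<Omega> \<epsilon>) u (x, \<epsilon> * f2 x)) < norm (boundary_gradient (\<Omega> \<epsilon>) u (x', \<epsilon> * f1 x'))"
  shows "fail_points (\<Omega> \<epsilon>) u \<subseteq> {(x, \<epsilon> * f1 x) | x. x \<in> {a..b}}"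
proof
  fix p assume p: "p \<in> fail_points (\<Omega> \<epsilon>) u"
  define x y where "x = fst p" and "y = snd p / \<epsilon>"
  have p_eq: "p = (x, \<epsilon> * y)" using \<open>\<epsilon> > 0\<close> by (simp add: x_def y_def)
  have max: "norm (boundary_gradient (\<Omega> \<epsilon>) u q) \<le> norm (boundary_gradient (\<Omega> \<epsilon>) u p)"
    if "q \<in> frontier (\<Omega> \<epsilon>)" for q
    using p that by (auto simp: fail_points_def)
  have "p \<in> frontier (\<Omega> \<epsilon>)" using p by (simp add: fail_points_def)
  then have x: "x \<in> {a..b}" and y: "y = f1 x \<or> y = f2 x"
    using mem_frontier_\<Omega>[OF \<open>\<epsilon> > 0\<close>] p_eq by auto
  have "y = f1 x"
  proof (rule ccontr)
    assume "y \<noteq> f1 x"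
    then have "y = f2 x" "x \<in> {a<..<b}" using x y ends by (auto simp: less_le)
    then obtain x' where "x' \<in> {a..b}"
      "norm (boundary_gradient (\<Omega> \<epsilon>) u p) < norm (boundary_gradient (\<Omega> \<epsilon>) u (x', \<epsilon> * f1 x'))"
      using less_somewhere p_eq by blast
    then show False using max[of "(x', \<epsilon> * f1 x')"] mem_frontier_\<Omega>[OF \<open>\<epsilon> > 0\<close>] by auto
  qed
  then show "p \<in> {(x, \<epsilon> * f1 x) | x. x \<in> {a..b}}" using p_eq x by blast
qed

end

theorem theorem1p2:
  fixes a b z0 :: real
    and f1 f2 :: "real \<Rightarrow> real"
    and u :: "real \<Rightarrow> real \<times> real \<Rightarrow> real"
  assumes "a < b"
    and "C2_on_Icc a b f1" and "C2_on_Icc a b f2"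
    and "f1 a = 0" and "f2 a = 0" and "f1 b = 0" and "f2 b = 0"
    and "\<And>x. x \<in> {a<..<b} \<Longrightarrow> f2 x > f1 x"
    and "convex_on {a..b} f1" and "concave_on {a..b} f2"
    and "\<And>\<epsilon>. \<epsilon> > 0 \<Longrightarrow> torsion_function (thin_domain a b f1 f2 \<epsilon>) (u \<epsilon>)"
    and "z0 \<in> {a<..<b}"
    and "\<And>x. is_arg_max (\<lambda>x. f2 x - f1 x) (\<lambda>x. x \<in> {a..b}) x \<longleftrightarrow> x = z0"
    and "lower_curvature f1 z0 < upper_curvature f2 z0"
  shows "(\<exists>\<epsilon>0>0. \<forall>\<epsilon>. 0 < \<epsilon> \<and> \<epsilon> < \<epsilon>0 \<longrightarrow>
            norm (boundary_gradient (thin_domain a b f1 f2 \<epsilon>) (u \<epsilon>) (z0, \<epsilon> * f1 z0))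
              > norm (boundary_gradient (thin_domain a b f1 f2 \<epsilon>) (u \<epsilon>) (z0, \<epsilon> * f2 z0))) \<and>
         (\<exists>\<epsilon>1>0. \<forall>\<epsilon>. 0 < \<epsilon> \<and> \<epsilon> < \<epsilon>1 \<longrightarrow>
            fail_points (thin_domain a b f1 f2 \<epsilon>) (u \<epsilon>) \<subseteq> {(x, \<epsilon> * f1 x) | x. x \<in> {a..b}})"
proof -
  obtain f1' f1'' where d1: "\<And>x. x \<in> {a..b} \<Longrightarrow> (f1 has_real_derivative f1' x) (at x within {a..b})"
    "\<And>x. x \<in> {a..b} \<Longrightarrow> (f1' has_real_derivative f1'' x) (at x within {a..b})"
    "continuous_on {a..b} f1''"
    using assms(2) unfolding C2_on_Icc_def by blast
  obtain f2' f2'' where d2: "\<And>x. x \<in> {a..b} \<Longrightarrow> (f2 has_real_derivative f2' x) (at x within {a..b})"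
    "\<And>x. x \<in> {a..b} \<Longrightarrow> (f2' has_real_derivative f2'' x) (at x within {a..b})"
    "continuous_on {a..b} f2''"
    using assms(3) unfolding C2_on_Icc_def by blast
  interpret profiles a b f1 f1' f1'' f2 f2' f2''
    using assms(1,4-8) d1 d2 by unfold_locales auto
  note z = assms(12)
  note tor = assms(11)
  \<comment> \<open>Uniqueness of the maximizer turns the weak inequality of
    \<open>is_arg_max\<close> into a strict one: a point attaining the same value would be a second
    maximizer.\<close>
  have max: "f2 x - f1 x < f2 z0 - f1 z0" if "x \<in> {a..b}" "x \<noteq> z0" for x
  proof (rule ccontr)
    assume "\<not> f2 x - f1 x < f2 z0 - f1 z0"
    moreover have "\<not> f2 z0 - f1 z0 < f2 y - f1 y" if "y \<in> {a..b}" for y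
      using assms(13)[of z0] that unfolding is_arg_max_def by blast
    ultimately have "is_arg_max (\<lambda>x. f2 x - f1 x) (\<lambda>x. x \<in> {a..b}) x"
      using that(1) unfolding is_arg_max_def by force
    then show False using assms(13) that(2) by blast
  qed
  have "f2' z0 - f1' z0 = 0"
  proof (rule DERIV_local_max)
    show "((\<lambda>x. f2 x - f1 x) has_real_derivative f2' z0 - f1' z0) (at z0)"
      by (intro derivative_intros at_interior z)
    show "0 < min (z0 - a) (b - z0)" using z by simp
    show "\<forall>y. \<bar>z0 - y\<bar> < min (z0 - a) (b - z0) \<longrightarrow> f2 y - f1 y \<le> f2 z0 - f1 z0"
      using max by (smt (verit) atLeastAtMost_iff)
  qed
  then have slopes: "f1' z0 = f2' z0" by simp
  have deriv_eq: "deriv f z0 = f' z0" "deriv (deriv f) z0 = f'' z0"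
    if "\<And>x. x \<in> {a<..<b} \<Longrightarrow> (f has_real_derivative f' x) (at x)"
      and "(f' has_real_derivative f'' z0) (at z0)" for f f' f'' :: "real \<Rightarrow> real"
  proof -
    have D: "deriv f x = f' x" if "x \<in> {a<..<b}" for x
      using \<open>\<And>x. x \<in> {a<..<b} \<Longrightarrow> (f has_real_derivative f' x) (at x)\<close>[OF that] by (rule DERIV_imp_deriv)
    then show "deriv f z0 = f' z0" using z by blast
    \<comment> \<open>The second derivative depends on \<open>deriv f\<close> near \<open>z0\<close>
      only, where it coincides with \<open>f'\<close>.\<close>
    have "(deriv f has_real_derivative f'' z0) (at z0)"
      by (rule DERIV_cong_ev[THEN iffD2, OF refl _ refl that(2)])
        (use z D in \<open>auto intro!: eventually_mono[OF eventually_nhds_in_open[of "{a<..<b}"]]\<close>)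
    then show "deriv (deriv f) z0 = f'' z0" by (rule DERIV_imp_deriv)
  qed
  \<comment> \<open>Equal slopes give both curvatures the same positive denominator, so the
    curvature hypothesis compares the numerators.\<close>
  have "f1'' z0 + f2'' z0 < 0"
  proof -
    have "deriv f1 z0 = f1' z0" "deriv f2 z0 = f2' z0"
      by (rule deriv_eq(1)[of f1 f1' f1''] deriv_eq(1)[of f2 f2' f2'']; use at_interior z in blast)+
    moreover have "deriv (deriv f1) z0 = f1'' z0" "deriv (deriv f2) z0 = f2'' z0"
      by (rule deriv_eq(2)[of f1 f1' f1''] deriv_eq(2)[of f2 f2' f2'']; use at_interior z in blast)+
    ultimately have "f1'' z0 / (1 + (f2' z0)\<^sup>2) powr (3 / 2) < - f2'' z0 / (1 + (f2' z0)\<^sup>2) powr (3 / 2)"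
      using assms(14) by (simp add: lower_curvature_def upper_curvature_def slopes)
    then have "f1'' z0 < - f2'' z0" unfolding divide_less_cancel by (auto simp: not_less[symmetric])
    then show ?thesis by simp
  qed
  then obtain \<delta> \<epsilon>0 where near: "\<delta> > 0" "\<epsilon>0 > 0"
    "\<And>\<epsilon> x. 0 < \<epsilon> \<Longrightarrow> \<epsilon> < \<epsilon>0 \<Longrightarrow> \<bar>x - z0\<bar> < \<delta> \<Longrightarrow>
       norm (boundary_gradient (\<Omega> \<epsilon>) (u \<epsilon>) (x, \<epsilon> * f2 x)) < norm (boundary_gradient (\<Omega> \<epsilon>) (u \<epsilon>) (x, \<epsilon> * f1 x))"
    using upper_graph_gradient_less_nearby[OF tor z slopes] by blast
  obtain \<epsilon>1 where far: "\<epsilon>1 > 0"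
    "\<And>\<epsilon> x. 0 < \<epsilon> \<Longrightarrow> \<epsilon> < \<epsilon>1 \<Longrightarrow> x \<in> {a<..<b} \<Longrightarrow> \<delta> \<le> \<bar>x - z0\<bar> \<Longrightarrow>
       norm (boundary_gradient (\<Omega> \<epsilon>) (u \<epsilon>) (x, \<epsilon> * f2 x)) < norm (boundary_gradient (\<Omega> \<epsilon>) (u \<epsilon>) (z0, \<epsilon> * f1 z0))"
    using upper_graph_gradient_less_far[OF tor z max near(1)] by blast
  have "fail_points (\<Omega> \<epsilon>) (u \<epsilon>) \<subseteq> {(x, \<epsilon> * f1 x) | x. x \<in> {a..b}}"
    if "0 < \<epsilon>" "\<epsilon> < min \<epsilon>0 \<epsilon>1" for \<epsilon>
  proof (rule fail_points_subset_lower_graph[OF that(1)])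
    fix x assume "x \<in> {a<..<b}"
    show "\<exists>x'\<in>{a..b}. norm (boundary_gradient (\<Omega> \<epsilon>) (u \<epsilon>) (x, \<epsilon> * f2 x))
        < norm (boundary_gradient (\<Omega> \<epsilon>) (u \<epsilon>) (x', \<epsilon> * f1 x'))"
    \<comment> \<open>An upper point near \<open>z0\<close> is beaten by the lower point over the
      same \<open>x\<close>, any other one by the lower point over \<open>z0\<close>.\<close>
    proof (cases "\<bar>x - z0\<bar> < \<delta>")
      case True
      then show ?thesis using near(3)[of \<epsilon> x] that \<open>x \<in> {a<..<b}\<close> by (intro bexI[of _ x]) simp_all
    next
      case False
      then show ?thesis
        using far(2)[of \<epsilon> x] that z \<open>x \<in> {a<..<b}\<close> by (intro bexI[of _ z0]) simp_all
    qed
  qed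
  moreover have "min \<epsilon>0 \<epsilon>1 > 0" using near(2) far(1) by simp
  ultimately have "\<exists>\<epsilon>1>0. \<forall>\<epsilon>. 0 < \<epsilon> \<and> \<epsilon> < \<epsilon>1 \<longrightarrow>
      fail_points (\<Omega> \<epsilon>) (u \<epsilon>) \<subseteq> {(x, \<epsilon> * f1 x) | x. x \<in> {a..b}}" by blast
  moreover have "norm (boundary_gradient (\<Omega> \<epsilon>) (u \<epsilon>) (z0, \<epsilon> * f2 z0))
      < norm (boundary_gradient (\<Omega> \<epsilon>) (u \<epsilon>) (z0, \<epsilon> * f1 z0))" if "0 < \<epsilon>" "\<epsilon> < \<epsilon>0" for \<epsilon>
    using near(3)[OF that, of z0] near(1) by simp
  ultimately show ?thesis using near(2) by blast
qed

end
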